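(* Let $G$ be a $4$-dimensional (real) Lie group with Lie algebra $\mathfrak{g}$. Then $G$ admits a left invariant anti-Kähler structure if and only if $\mathfrak{g}$ is abelian or is isomorphic to one of the following two real Lie algebras with basis $\{e_1,e_2,e_3,e_4\}$ (brackets of basis vectors not determined by those listed via skew-symmetry are zero): $$\mathfrak{r}_{-1,-1}:\quad [e_1,e_2]=e_2,\ [e_1,e_3]=-e_3,\ [e_1,e_4]=-e_4,$$ $$\mathfrak{aff}(\mathbb{C})_{\mathbb{R}}:\quad [e_1,e_3]=e_3,\ [e_1,e_4]=e_4,\ [e_2,e_3]=e_4,\ [e_2,e_4]=-e_3.$$
   Context: The Lie algebra $\mathfrak{g}$ of $G$ is the space of left invariant vector fields on $G$. A left invariant anti-Kähler structure on $G$ is a pair $(g,J)$ where $g$ is a left invariant pseudo-Riemannian metric on $G$, $J$ is a left invariant almost complex structure on $G$ (so $J$ maps $\mathfrak{g}$ to $\mathfrak{g}$ and $J^2=-\mathrm{Id}$), $g(JX,JY)=-g(X,Y)$ for all $X,Y$, and $\nabla J=0$ where $\nabla$ is the Levi-Civita connection of $g$. *)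

theory Defs
  imports "HOL-Analysis.Analysis" "HOL-Library.Function_Algebras"
begin

section \<open>Smooth maps between normed spaces\<close>

text \<open>
  Only used for functions on finite-dimensional spaces and on open sets; there, continuity of
  all iterated directional derivatives is the usual $C^k$ condition.
\<close>

fun Ck_on :: "nat \<Rightarrow> 'a::real_normed_vector set \<Rightarrow> ('a \<Rightarrow> 'b::real_normed_vector) \<Rightarrow> bool" where
  "Ck_on 0 S f \<longleftrightarrow> continuous_on S f"
| "Ck_on (Suc k) S f \<longleftrightarrow>
     (\<forall>x\<in>S. f differentiable (at x)) \<and>
     (\<forall>v. Ck_on k S (\<lambda>x. frechet_derivative f (at x) v))"

definition smooth_on :: "'a::real_normed_vector set \<Rightarrow> ('a \<Rightarrow> 'b::real_normed_vector) \<Rightarrow> bool" where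
  "smooth_on S f \<longleftrightarrow> (\<forall>k. Ck_on k S f)"

section \<open>Lie groups\<close>

text \<open>
  A chart is a domain together with a coordinate map; the values of the map outside the domain
  are irrelevant.
\<close>

type_synonym ('g, 'e) chart = "'g set \<times> ('g \<Rightarrow> 'e)"
type_synonym ('g, 'e) atlas = "('g, 'e) chart set"

definition is_chart :: "('g::topological_space, 'e::euclidean_space) chart \<Rightarrow> bool" where
  "is_chart c \<longleftrightarrow> (case c of (U, \<phi>) \<Rightarrow>
     open U \<and> open (\<phi> ` U) \<and> homeomorphism U (\<phi> ` U) \<phi> (inv_into U \<phi>))"

definition smooth_atlas :: "('g::topological_space, 'e::euclidean_space) atlas \<Rightarrow> bool" where
  "smooth_atlas A \<longleftrightarrow>
     (\<forall>c\<in>A. is_chart c) \<and>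
     (\<Union>(U, \<phi>)\<in>A. U) = UNIV \<and>
     (\<forall>(U, \<phi>)\<in>A. \<forall>(V, \<psi>)\<in>A. smooth_on (\<phi> ` (U \<inter> V)) (\<psi> \<circ> inv_into U \<phi>))"

text \<open>
  The underlying group is an arbitrary, not necessarily commutative, topological group; as in the
  class \<^class>\<open>group_add\<close> of the library it is written additively.
\<close>

definition lie_group ::
  "('g::{topological_group_add, t2_space, second_countable_topology}, 'e::euclidean_space) atlas \<Rightarrow> bool"
  where
  "lie_group A \<longleftrightarrow>
     smooth_atlas A \<and>
     (\<forall>(U, \<phi>)\<in>A. \<forall>(V, \<psi>)\<in>A. \<forall>(W, \<theta>)\<in>A.
        smooth_on
          {(x, y). x \<in> \<phi> ` U \<and> y \<in> \<psi> ` V \<and> inv_into U \<phi> x + inv_into V \<psi> y \<in> W}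
          (\<lambda>(x, y). \<theta> (inv_into U \<phi> x + inv_into V \<psi> y))) \<and>
     (\<forall>(U, \<phi>)\<in>A. \<forall>(V, \<psi>)\<in>A.
        smooth_on {x \<in> \<phi> ` U. - inv_into U \<phi> x \<in> V} (\<lambda>x. \<psi> (- inv_into U \<phi> x)))"

section \<open>Smooth functions, tangent vectors and vector fields\<close>

definition smooth_fun_on ::
  "('g::topological_space, 'e::euclidean_space) atlas \<Rightarrow> 'g set \<Rightarrow> ('g \<Rightarrow> real) \<Rightarrow> bool" where
  "smooth_fun_on A S f \<longleftrightarrow> (\<forall>(U, \<phi>)\<in>A. smooth_on (\<phi> ` (U \<inter> S)) (f \<circ> inv_into U \<phi>))"

definition smooth_near ::
  "('g::topological_space, 'e::euclidean_space) atlas \<Rightarrow> 'g \<Rightarrow> ('g \<Rightarrow> real) \<Rightarrow> bool" where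
  "smooth_near A p f \<longleftrightarrow> (\<exists>S. open S \<and> p \<in> S \<and> smooth_fun_on A S f)"

definition smooth_curve ::
  "('g::topological_space, 'e::euclidean_space) atlas \<Rightarrow> real \<Rightarrow> (real \<Rightarrow> 'g) \<Rightarrow> bool" where
  "smooth_curve A \<epsilon> \<gamma> \<longleftrightarrow>
     continuous_on {-\<epsilon><..<\<epsilon>} \<gamma> \<and>
     (\<forall>(U, \<phi>)\<in>A. smooth_on {t \<in> {-\<epsilon><..<\<epsilon>}. \<gamma> t \<in> U} (\<phi> \<circ> \<gamma>))"

text \<open>
  A tangent vector at \<open>p\<close> is the velocity at time 0 of a smooth curve through \<open>p\<close>, regarded as a
  functional on the functions that are smooth near \<open>p\<close>. On all other functions it is set to 0, so
  that equality of tangent vectors is equality in HOL. Addition is the pointwise one.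
\<close>

type_synonym 'g tvec = "('g \<Rightarrow> real) \<Rightarrow> real"

definition velocity ::
  "('g::topological_space, 'e::euclidean_space) atlas \<Rightarrow> (real \<Rightarrow> 'g) \<Rightarrow> 'g tvec" where
  "velocity A \<gamma> = (\<lambda>f. if smooth_near A (\<gamma> 0) f then deriv (f \<circ> \<gamma>) 0 else 0)"

definition tangent_space ::
  "('g::topological_space, 'e::euclidean_space) atlas \<Rightarrow> 'g \<Rightarrow> 'g tvec set" where
  "tangent_space A p = {velocity A \<gamma> |\<gamma> \<epsilon>. \<epsilon> > 0 \<and> smooth_curve A \<epsilon> \<gamma> \<and> \<gamma> 0 = p}"

definition tscale :: "real \<Rightarrow> 'g tvec \<Rightarrow> 'g tvec" where
  "tscale c v = (\<lambda>f. c * v f)"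

type_synonym 'g vfield = "'g \<Rightarrow> 'g tvec"

definition vector_fields ::
  "('g::topological_space, 'e::euclidean_space) atlas \<Rightarrow> 'g vfield set" where
  "vector_fields A = {X.
     (\<forall>p. X p \<in> tangent_space A p) \<and>
     (\<forall>S f. open S \<longrightarrow> smooth_fun_on A S f \<longrightarrow> smooth_fun_on A S (\<lambda>p. X p f))}"

definition fscale :: "('g \<Rightarrow> real) \<Rightarrow> 'g vfield \<Rightarrow> 'g vfield" where
  "fscale u X = (\<lambda>p. tscale (u p) (X p))"

definition lie_bracket ::
  "('g::topological_space, 'e::euclidean_space) atlas \<Rightarrow> 'g vfield \<Rightarrow> 'g vfield \<Rightarrow> 'g vfield" where
  "lie_bracket A X Y =
     (\<lambda>p f. if smooth_near A p f then X p (\<lambda>q. Y q f) - Y p (\<lambda>q. X q f) else 0)"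

section \<open>The Lie algebra of a Lie group\<close>

text \<open>
  The differential of the left translation by \<open>a\<close>. Since the translation is a diffeomorphism,
  the convention that tangent vectors vanish on nonsmooth functions is preserved.
\<close>

definition dleft :: "'g::group_add \<Rightarrow> 'g tvec \<Rightarrow> 'g tvec" where
  "dleft a v = (\<lambda>f. v (\<lambda>q. f (a + q)))"

definition lie_algebra ::
  "('g::{topological_group_add, t2_space, second_countable_topology}, 'e::euclidean_space) atlas
     \<Rightarrow> 'g vfield set" where
  "lie_algebra A = {X \<in> vector_fields A. \<forall>a p. X (a + p) = dleft a (X p)}"

definition abelian_lie_algebra ::
  "('g::{topological_group_add, t2_space, second_countable_topology}, 'e::euclidean_space) atlas
     \<Rightarrow> bool" where
  "abelian_lie_algebra A \<longleftrightarrow> (\<forall>X\<in>lie_algebra A. \<forall>Y\<in>lie_algebra A. lie_bracket A X Y = 0)"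

text \<open>
  Isomorphism of the Lie algebra of the group with the Lie algebra structure on the vector space
  \<open>'v\<close> whose bracket is \<open>br\<close>.
\<close>

definition lie_algebra_iso ::
  "('g::{topological_group_add, t2_space, second_countable_topology}, 'e::euclidean_space) atlas
     \<Rightarrow> ('v::real_vector \<Rightarrow> 'v \<Rightarrow> 'v) \<Rightarrow> bool" where
  "lie_algebra_iso A br \<longleftrightarrow> (\<exists>\<Phi>.
     bij_betw \<Phi> UNIV (lie_algebra A) \<and>
     (\<forall>x y. \<Phi> (x + y) = \<Phi> x + \<Phi> y) \<and>
     (\<forall>c x. \<Phi> (c *\<^sub>R x) = fscale (\<lambda>_. c) (\<Phi> x)) \<and>
     (\<forall>x y. \<Phi> (br x y) = lie_bracket A (\<Phi> x) (\<Phi> y)))"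

section \<open>Left invariant anti-Kaehler structures\<close>

definition pseudo_riemannian_metric ::
  "('g::topological_space, 'e::euclidean_space) atlas \<Rightarrow> ('g \<Rightarrow> 'g tvec \<Rightarrow> 'g tvec \<Rightarrow> real) \<Rightarrow> bool"
  where
  "pseudo_riemannian_metric A g \<longleftrightarrow>
     (\<forall>p. \<forall>u\<in>tangent_space A p. \<forall>v\<in>tangent_space A p.
        g p u v = g p v u \<and>
        (\<forall>w\<in>tangent_space A p. g p (u + v) w = g p u w + g p v w) \<and>
        (\<forall>c. g p (tscale c u) v = c * g p u v)) \<and>
     (\<forall>p. \<forall>u\<in>tangent_space A p. (\<forall>v\<in>tangent_space A p. g p u v = 0) \<longrightarrow> u = 0) \<and>
     (\<forall>X\<in>vector_fields A. \<forall>Y\<in>vector_fields A. smooth_fun_on A UNIV (\<lambda>p. g p (X p) (Y p)))"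

definition almost_complex_structure ::
  "('g::topological_space, 'e::euclidean_space) atlas \<Rightarrow> ('g \<Rightarrow> 'g tvec \<Rightarrow> 'g tvec) \<Rightarrow> bool" where
  "almost_complex_structure A J \<longleftrightarrow>
     (\<forall>p. \<forall>u\<in>tangent_space A p.
        J p u \<in> tangent_space A p \<and>
        (\<forall>v\<in>tangent_space A p. J p (u + v) = J p u + J p v) \<and>
        (\<forall>c. J p (tscale c u) = tscale c (J p u)) \<and>
        J p (J p u) = - u) \<and>
     (\<forall>X\<in>vector_fields A. (\<lambda>p. J p (X p)) \<in> vector_fields A)"

definition affine_connection ::
  "('g::topological_space, 'e::euclidean_space) atlas \<Rightarrow> ('g vfield \<Rightarrow> 'g vfield \<Rightarrow> 'g vfield) \<Rightarrow> bool"
  where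
  "affine_connection A D \<longleftrightarrow>
     (\<forall>X\<in>vector_fields A. \<forall>Y\<in>vector_fields A. D X Y \<in> vector_fields A) \<and>
     (\<forall>X\<in>vector_fields A. \<forall>Y\<in>vector_fields A. \<forall>Z\<in>vector_fields A.
        D (X + Y) Z = D X Z + D Y Z \<and> D X (Y + Z) = D X Y + D X Z) \<and>
     (\<forall>X\<in>vector_fields A. \<forall>Y\<in>vector_fields A. \<forall>u. smooth_fun_on A UNIV u \<longrightarrow>
        D (fscale u X) Y = fscale u (D X Y) \<and>
        D X (fscale u Y) = fscale (\<lambda>p. X p u) Y + fscale u (D X Y))"

definition levi_civita_connection ::
  "('g::topological_space, 'e::euclidean_space) atlas \<Rightarrow> ('g \<Rightarrow> 'g tvec \<Rightarrow> 'g tvec \<Rightarrow> real)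
     \<Rightarrow> ('g vfield \<Rightarrow> 'g vfield \<Rightarrow> 'g vfield) \<Rightarrow> bool" where
  "levi_civita_connection A g D \<longleftrightarrow>
     affine_connection A D \<and>
     (\<forall>X\<in>vector_fields A. \<forall>Y\<in>vector_fields A. D X Y - D Y X = lie_bracket A X Y) \<and>
     (\<forall>X\<in>vector_fields A. \<forall>Y\<in>vector_fields A. \<forall>Z\<in>vector_fields A. \<forall>p.
        X p (\<lambda>q. g q (Y q) (Z q)) = g p (D X Y p) (Z p) + g p (Y p) (D X Z p))"

text \<open>
  The Levi-Civita connection exists and is unique (on arguments that are smooth vector fields), so
  the existential quantifier over \<open>D\<close> merely names it.
\<close>

definition anti_kaehler ::
  "('g::topological_space, 'e::euclidean_space) atlas \<Rightarrow> ('g \<Rightarrow> 'g tvec \<Rightarrow> 'g tvec \<Rightarrow> real)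
     \<Rightarrow> ('g \<Rightarrow> 'g tvec \<Rightarrow> 'g tvec) \<Rightarrow> bool" where
  "anti_kaehler A g J \<longleftrightarrow>
     pseudo_riemannian_metric A g \<and>
     almost_complex_structure A J \<and>
     (\<forall>p. \<forall>u\<in>tangent_space A p. \<forall>v\<in>tangent_space A p. g p (J p u) (J p v) = - g p u v) \<and>
     (\<exists>D. levi_civita_connection A g D \<and>
        (\<forall>X\<in>vector_fields A. \<forall>Y\<in>vector_fields A.
           D X (\<lambda>p. J p (Y p)) = (\<lambda>p. J p (D X Y p))))"

definition left_invariant_anti_kaehler ::
  "('g::{topological_group_add, t2_space, second_countable_topology}, 'e::euclidean_space) atlas
     \<Rightarrow> ('g \<Rightarrow> 'g tvec \<Rightarrow> 'g tvec \<Rightarrow> real) \<Rightarrow> ('g \<Rightarrow> 'g tvec \<Rightarrow> 'g tvec) \<Rightarrow> bool" where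
  "left_invariant_anti_kaehler A g J \<longleftrightarrow>
     anti_kaehler A g J \<and>
     (\<forall>a p. \<forall>u\<in>tangent_space A p. \<forall>v\<in>tangent_space A p.
        g (a + p) (dleft a u) (dleft a v) = g p u v) \<and>
     (\<forall>a p. \<forall>u\<in>tangent_space A p. J (a + p) (dleft a u) = dleft a (J p u))"

section \<open>The two model Lie algebras\<close>

text \<open>
  The bilinear skew-symmetric bracket determined by a table \<open>B\<close> in which each nonzero bracket
  of basis vectors is listed in one order only. In type \<open>4\<close> the numeral \<open>4\<close> equals \<open>0\<close>; the four
  indices \<open>1, 2, 3, 4\<close> are distinct and exhaust the type.
\<close>

definition table_bracket :: "(4 \<Rightarrow> 4 \<Rightarrow> real^4) \<Rightarrow> real^4 \<Rightarrow> real^4 \<Rightarrow> real^4" where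
  "table_bracket B x y = (\<Sum>i\<in>UNIV. \<Sum>j\<in>UNIV. (x $ i * y $ j - x $ j * y $ i) *\<^sub>R B i j)"

definition bracket_r :: "real^4 \<Rightarrow> real^4 \<Rightarrow> real^4" where
  "bracket_r = table_bracket (\<lambda>i j.
     if (i, j) = (1, 2) then axis 2 1
     else if (i, j) = (1, 3) then - axis 3 1
     else if (i, j) = (1, 4) then - axis 4 1
     else 0)"

definition bracket_aff :: "real^4 \<Rightarrow> real^4 \<Rightarrow> real^4" where
  "bracket_aff = table_bracket (\<lambda>i j.
     if (i, j) = (1, 3) then axis 3 1
     else if (i, j) = (1, 4) then axis 4 1
     else if (i, j) = (2, 3) then axis 4 1
     else if (i, j) = (2, 4) then - axis 3 1
     else 0)"

end

theory Submission
  imports Defs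
begin

text \<open>
  A left invariant anti-Kaehler structure is determined by its values on the Lie algebra
  \<open>\<gg>\<close>: a form \<open>g\<close>, a complex structure \<open>J\<close> and the bilinear map
  \<open>\<Gamma> x y = \<nabla>\<^sub>x y\<close>. The form \<open>g - \<i> g(J\<cdot>, \<cdot>)\<close> is complex bilinear, and
  every \<open>\<Gamma> x\<close> is complex linear and skew for it, so in dimension four it lies in
  the complex line \<open>so(2, C)\<close>. In a null basis \<open>\<Gamma> x = diag(\<rho> x, - \<rho> x)\<close> with
  \<open>\<rho> = a z\<^sub>1 + b cnj z\<^sub>1 + c z\<^sub>2 + d cnj z\<^sub>2\<close>, and the Jacobi identity becomes five
  quadratic equations for the coefficients: \<open>\<rho>\<close> is \<open>2 Re (cnj b z\<^sub>1)\<close> or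
  \<open>2 Re (cnj d z\<^sub>2)\<close>, which gives the first model algebra, or complex linear, which gives the
  second one or the abelian one. Conversely each of these brackets is torsion free for such a
  \<open>\<Gamma>\<close>, and a left invariant frame turns \<open>\<Gamma>\<close> into the Levi-Civita connection
  \<open>\<nabla>\<^sub>X Y = X(y) + \<Gamma> x y\<close>, where \<open>x\<close> and \<open>y\<close> are the coefficient functions of
  \<open>X\<close> and \<open>Y\<close>.
\<close>

section \<open>Calculus of smooth maps\<close>

text \<open>Tangent vectors are functionals that vanish on non-smooth functions, and smoothness is
  defined for real functions only; so vector valued objects are handled by components, and some
  identities between fields need a separate look at functions that are not smooth. The analytic
  obstacle is the smoothness of frame coefficients: without it the formula for the connection would
  not send arbitrary fields to fields. It comes from the joint smoothness of
  \<open>f (a + q)\<close> and \<open>- a\<close> in all variables. On the algebraic side a complex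
  symmetric form has no signature, since complex square roots normalise every non-null vector, so a
  single normal form covers all metrics. The shape of the models can then be predicted. If \<rho> is
  real valued, a vector with \<open>\<rho> = 1\<close> acts on the abelian kernel of \<rho> by 1 on
  a real line and by -1 on a complex line. If \<rho> is complex linear and nonzero, the bracket is
  complex bilinear with a one-dimensional derived algebra, which leaves only the affine
  algebra.\<close>

lemma has_derivative_cong_open:
  assumes "open S" "x \<in> S" "\<And>y. y \<in> S \<Longrightarrow> f y = g y"
  shows "(f has_derivative D) (at x) \<longleftrightarrow> (g has_derivative D) (at x)"
  using assms has_derivative_transform_within_open[of f D x UNIV S g]
    has_derivative_transform_within_open[of g D x UNIV S f] by auto

lemma frechet_derivative_cong_open:
  assumes "open S" "x \<in> S" "\<And>y. y \<in> S \<Longrightarrow> f y = g y"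
  shows "frechet_derivative f (at x) = frechet_derivative g (at x)"
  unfolding frechet_derivative_def using has_derivative_cong_open[OF assms] by simp

lemma Ck_on_cong:
  assumes "open S" "\<And>x. x \<in> S \<Longrightarrow> f x = g x" "Ck_on k S f"
  shows "Ck_on k S g"
  using assms(2,3)
proof (induction k arbitrary: f g)
  case 0
  then show ?case using continuous_on_cong[of S S f g] by simp
next
  case (Suc k)
  have "g differentiable (at x)" if "x \<in> S" for x
    using Suc.prems that has_derivative_cong_open[OF assms(1) that, of f g]
    by (fastforce simp: differentiable_def)
  moreover have "Ck_on k S (\<lambda>x. frechet_derivative g (at x) v)" for v
    by (rule Suc.IH[of "\<lambda>x. frechet_derivative f (at x) v"])
      (use Suc.prems frechet_derivative_cong_open[OF assms(1), of _ f g] in auto)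
  ultimately show ?case by simp
qed

text \<open>\<open>frechet_derivative\<close> is a choice operator. Uniqueness of derivatives
  identifies it with \<open>f'\<close> on \<open>S\<close>, and openness of \<open>S\<close> lets
  \<open>Ck_on_cong\<close> carry this agreement to the higher derivatives.\<close>

lemma Ck_on_SucI:
  assumes "open S" "\<And>x. x \<in> S \<Longrightarrow> (f has_derivative f' x) (at x)"
    "\<And>v. Ck_on k S (\<lambda>x. f' x v)"
  shows "Ck_on (Suc k) S f"
proof -
  have "Ck_on k S (\<lambda>x. frechet_derivative f (at x) v)" for v
    by (rule Ck_on_cong[OF assms(1) _ assms(3)[of v]]) (use frechet_derivative_at[OF assms(2)] in auto)
  then show ?thesis using assms(2) by (auto simp: differentiable_def)
qed

lemma Ck_on_SucD:
  assumes "Ck_on (Suc k) S f"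
  shows "x \<in> S \<Longrightarrow> (f has_derivative frechet_derivative f (at x)) (at x)"
    and "Ck_on k S (\<lambda>x. frechet_derivative f (at x) v)"
  using assms by (auto simp: frechet_derivative_works)

lemma Ck_on_Suc_imp: "Ck_on (Suc k) S f \<Longrightarrow> Ck_on k S f"
proof (induction k arbitrary: f)
  case 0
  then show ?case
    by (auto intro!: continuous_at_imp_continuous_on differentiable_imp_continuous_within)
next
  case (Suc k)
  then show ?case by (metis Ck_on.simps(2))
qed

lemma Ck_on_subset: "Ck_on k S f \<Longrightarrow> T \<subseteq> S \<Longrightarrow> Ck_on k T f"
  by (induction k arbitrary: f) (auto intro: continuous_on_subset)

lemma Ck_on_local:
  assumes "\<And>x. x \<in> S \<Longrightarrow> \<exists>T. open T \<and> x \<in> T \<and> Ck_on k T f"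
  shows "Ck_on k S f"
  using assms
proof (induction k arbitrary: f)
  case 0
  then show ?case
    by (auto intro!: continuous_at_imp_continuous_on) (metis continuous_on_eq_continuous_at)
next
  case (Suc k)
  have "f differentiable at x" if "x \<in> S" for x
    using Suc.prems[OF that] by auto
  moreover have "Ck_on k S (\<lambda>x. frechet_derivative f (at x) v)" for v
    by (rule Suc.IH) (use Suc.prems in fastforce)
  ultimately show ?case by simp
qed

lemma Ck_on_const: "open S \<Longrightarrow> Ck_on k S (\<lambda>x. c)"
proof (induction k arbitrary: c)
  case (Suc k)
  show ?case by (rule Ck_on_SucI[where f'="\<lambda>x v. 0"]) (use Suc in auto)
qed simp

lemma Ck_on_bounded_linear:
  assumes "bounded_linear l" "open S" "Ck_on k S f"
  shows "Ck_on k S (\<lambda>x. l (f x))"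
  using assms(3)
proof (induction k arbitrary: f)
  case 0
  then show ?case using assms(1) by (simp add: bounded_linear.continuous_on)
next
  case (Suc k)
  note f = Ck_on_SucD[OF Suc.prems]
  show ?case
    by (rule Ck_on_SucI[OF assms(2) bounded_linear.has_derivative[OF assms(1) f(1)]])
      (assumption, rule Suc.IH, rule f(2))
qed

lemma Ck_on_add:
  assumes "open S" "Ck_on k S f" "Ck_on k S g"
  shows "Ck_on k S (\<lambda>x. f x + g x)"
  using assms(2,3)
proof (induction k arbitrary: f g)
  case 0
  then show ?case by (simp add: continuous_on_add)
next
  case (Suc k)
  show ?case
    by (rule Ck_on_SucI[OF assms(1) has_derivative_add[OF Ck_on_SucD(1)[OF Suc.prems(1)]
          Ck_on_SucD(1)[OF Suc.prems(2)]]])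
      (auto intro!: Suc.IH Ck_on_SucD(2)[OF Suc.prems(1)] Ck_on_SucD(2)[OF Suc.prems(2)] simp del: Ck_on.simps)
qed

text \<open>The Leibniz rule pairs each factor with the derivative of the other, so the
  undifferentiated factors enter one order lower; \<open>Ck_on_Suc_imp\<close> supplies
  this.\<close>

lemma Ck_on_bilinear:
  assumes "bounded_bilinear p" "open S" "Ck_on k S f" "Ck_on k S g"
  shows "Ck_on k S (\<lambda>x. p (f x) (g x))"
  using assms(3,4)
proof (induction k arbitrary: f g)
  case 0
  then show ?case using assms(1) by (simp add: bounded_bilinear.continuous_on)
next
  case (Suc k)
  note 1 = Ck_on_SucD[OF Suc.prems(1)] and 2 = Ck_on_SucD[OF Suc.prems(2)]
  show ?case
    by (rule Ck_on_SucI[OF assms(2) bounded_bilinear.FDERIV[OF assms(1) 1(1) 2(1)]])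
      (auto intro!: Ck_on_add[OF assms(2)] Suc.IH 1(2) 2(2) Ck_on_Suc_imp[OF Suc.prems(1)]
        Ck_on_Suc_imp[OF Suc.prems(2)] simp del: Ck_on.simps)
qed

lemma Ck_on_sum:
  "open S \<Longrightarrow> (\<And>i. i \<in> I \<Longrightarrow> Ck_on k S (f i)) \<Longrightarrow> Ck_on k S (\<lambda>x. \<Sum>i\<in>I. f i x)"
  by (induction I rule: infinite_finite_induct) (auto intro: Ck_on_add Ck_on_const)

lemma Ck_on_id: "open S \<Longrightarrow> Ck_on k S (\<lambda>x. x)"
  by (cases k) (auto intro!: Ck_on_const Ck_on_SucI[where f'="\<lambda>x v. v"] simp del: Ck_on.simps(2))

lemma has_derivative_sum_Basis:
  fixes f :: "'a::euclidean_space \<Rightarrow> 'b::real_normed_vector"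
  assumes "(f has_derivative D) F"
  shows "D v = (\<Sum>b\<in>Basis. (v \<bullet> b) *\<^sub>R D b)"
proof -
  interpret linear D using assms by (rule has_derivative_linear)
  have "D v = D (\<Sum>b\<in>Basis. (v \<bullet> b) *\<^sub>R b)" by (simp add: euclidean_representation)
  then show ?thesis by (simp add: sum scaleR)
qed

lemma Ck_on_compose:
  fixes f :: "'a::real_normed_vector \<Rightarrow> 'b::euclidean_space" and g :: "'b \<Rightarrow> 'c::real_normed_vector"
  assumes "open S" "open T" "f ` S \<subseteq> T" "Ck_on k S f" "Ck_on k T g"
  shows "Ck_on k S (\<lambda>x. g (f x))"
  using assms(4,5)
proof (induction k arbitrary: g)
  case 0
  then show ?case using assms(3) by (auto intro: continuous_on_compose2)
next
  case (Suc k)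
  note f = Ck_on_SucD[OF Suc.prems(1)] and g = Ck_on_SucD[OF Suc.prems(2)]
  \<comment> \<open>The chain rule differentiates \<open>g\<close> in a direction that varies with
    \<open>x\<close>, while \<open>Ck_on\<close> controls fixed directions only. Expanding over
    \<open>Basis\<close> leaves fixed directions with variable scalar factors; hence the Euclidean
    middle space.\<close>
  have *: "((\<lambda>x. g (f x)) has_derivative
      (\<lambda>v. \<Sum>b\<in>Basis. (frechet_derivative f (at x) v \<bullet> b) *\<^sub>R frechet_derivative g (at (f x)) b)) (at x)"
    if "x \<in> S" for x
  proof -
    have "f x \<in> T" using that assms(3) by auto
    have "(\<lambda>v. frechet_derivative g (at (f x)) (frechet_derivative f (at x) v)) =
        (\<lambda>v. \<Sum>b\<in>Basis. (frechet_derivative f (at x) v \<bullet> b) *\<^sub>R frechet_derivative g (at (f x)) b)"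
      by (rule ext) (rule has_derivative_sum_Basis[OF g(1)[OF \<open>f x \<in> T\<close>]])
    with diff_chain_at[OF f(1)[OF that] g(1)[OF \<open>f x \<in> T\<close>]]
    show ?thesis by (simp only: o_def)
  qed
  show ?case
    by (rule Ck_on_SucI[OF assms(1) *])
      (auto intro!: Ck_on_sum[OF assms(1)] Ck_on_bilinear[OF bounded_bilinear_scaleR assms(1)]
          Ck_on_bounded_linear[OF bounded_linear_inner_left assms(1) f(2)]
          Suc.IH[OF Ck_on_Suc_imp[OF Suc.prems(1)] g(2)] simp del: Ck_on.simps)
qed

lemma smooth_on_cong:
  "smooth_on S f \<Longrightarrow> open S \<Longrightarrow> (\<And>x. x \<in> S \<Longrightarrow> f x = g x) \<Longrightarrow> smooth_on S g"
  unfolding smooth_on_def using Ck_on_cong by blast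

lemma smooth_on_subset: "smooth_on S f \<Longrightarrow> T \<subseteq> S \<Longrightarrow> smooth_on T f"
  unfolding smooth_on_def using Ck_on_subset by blast

lemma smooth_on_local:
  "(\<And>x. x \<in> S \<Longrightarrow> \<exists>T. open T \<and> x \<in> T \<and> smooth_on T f) \<Longrightarrow> smooth_on S f"
  unfolding smooth_on_def using Ck_on_local by metis

lemma smooth_on_const: "open S \<Longrightarrow> smooth_on S (\<lambda>x. c)"
  by (simp add: smooth_on_def Ck_on_const)

lemma smooth_on_id: "open S \<Longrightarrow> smooth_on S (\<lambda>x. x)"
  by (simp add: smooth_on_def Ck_on_id)

lemma smooth_on_bounded_linear:
  "bounded_linear l \<Longrightarrow> open S \<Longrightarrow> smooth_on S f \<Longrightarrow> smooth_on S (\<lambda>x. l (f x))"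
  by (simp add: smooth_on_def Ck_on_bounded_linear)

lemma smooth_on_add:
  "open S \<Longrightarrow> smooth_on S f \<Longrightarrow> smooth_on S g \<Longrightarrow> smooth_on S (\<lambda>x. f x + g x)"
  by (simp add: smooth_on_def Ck_on_add)

lemma smooth_on_bilinear:
  "bounded_bilinear p \<Longrightarrow> open S \<Longrightarrow> smooth_on S f \<Longrightarrow> smooth_on S g \<Longrightarrow> smooth_on S (\<lambda>x. p (f x) (g x))"
  by (simp add: smooth_on_def Ck_on_bilinear)

lemma smooth_on_Pair:
  assumes "open S" "smooth_on S f" "smooth_on S g"
  shows "smooth_on S (\<lambda>x. (f x, g x))"
proof -
  have "bounded_linear (\<lambda>x::'b. (x, 0::'c))" "bounded_linear (\<lambda>y::'c. (0::'b, y))"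
    by (auto intro!: bounded_linear_Pair bounded_linear_ident bounded_linear_zero)
  from smooth_on_add[OF assms(1) smooth_on_bounded_linear[OF this(1) assms(1,2)]
      smooth_on_bounded_linear[OF this(2) assms(1,3)]]
  show ?thesis by simp
qed

lemma smooth_on_compose:
  fixes f :: "'a::real_normed_vector \<Rightarrow> 'b::euclidean_space" and g :: "'b \<Rightarrow> 'c::real_normed_vector"
  assumes "smooth_on T g" "smooth_on S f" "open S" "open T" "f ` S \<subseteq> T"
  shows "smooth_on S (\<lambda>x. g (f x))"
  using assms unfolding smooth_on_def by (blast intro: Ck_on_compose)

lemma smooth_on_continuous_on: "smooth_on S f \<Longrightarrow> continuous_on S f"
  unfolding smooth_on_def by (metis Ck_on.simps(1))

lemma smooth_on_has_derivative:
  "smooth_on S f \<Longrightarrow> x \<in> S \<Longrightarrow> (f has_derivative frechet_derivative f (at x)) (at x)"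
  unfolding smooth_on_def using Ck_on_SucD(1) by blast

lemma smooth_on_frechet_derivative:
  "smooth_on S f \<Longrightarrow> smooth_on S (\<lambda>x. frechet_derivative f (at x) v)"
  unfolding smooth_on_def using Ck_on_SucD(2) by blast

section \<open>Tangent vectors in charts\<close>

text \<open>The vector at \<open>p\<close> with coordinates \<open>v\<close>. It follows the zero
  convention of \<open>velocity\<close>, so that it can equal a velocity as a HOL function.\<close>

definition chart_vec ::
  "('g::topological_space, 'e::euclidean_space) atlas \<Rightarrow> 'g set \<Rightarrow> ('g \<Rightarrow> 'e) \<Rightarrow> 'g \<Rightarrow> 'e \<Rightarrow> 'g tvec" where
  "chart_vec A U \<phi> p v =
     (\<lambda>f. if smooth_near A p f then frechet_derivative (f \<circ> inv_into U \<phi>) (at (\<phi> p)) v else 0)"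

locale smooth_mfd =
  fixes A :: "('g::topological_space, 'e::euclidean_space) atlas"
  assumes smooth_atlas: "smooth_atlas A"
begin

lemma
  assumes "(U, \<phi>) \<in> A"
  shows chart_open: "open U" and chart_open_range: "open (\<phi> ` U)"
    and chart_inv: "p \<in> U \<Longrightarrow> inv_into U \<phi> (\<phi> p) = p"
    and chart_cont: "continuous_on U \<phi>"
    and chart_inv_cont: "continuous_on (\<phi> ` U) (inv_into U \<phi>)"
proof -
  have "open U \<and> open (\<phi> ` U) \<and> homeomorphism U (\<phi> ` U) \<phi> (inv_into U \<phi>)"
    using smooth_atlas assms unfolding smooth_atlas_def is_chart_def by auto
  then show "open U" "open (\<phi> ` U)" "p \<in> U \<Longrightarrow> inv_into U \<phi> (\<phi> p) = p"
    "continuous_on U \<phi>" "continuous_on (\<phi> ` U) (inv_into U \<phi>)"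
    unfolding homeomorphism_def by auto
qed

lemma transition_smooth:
  "(U, \<phi>) \<in> A \<Longrightarrow> (V, \<psi>) \<in> A \<Longrightarrow> smooth_on (\<phi> ` (U \<inter> V)) (\<psi> \<circ> inv_into U \<phi>)"
  using smooth_atlas unfolding smooth_atlas_def by auto

lemma chart_at:
  obtains U \<phi> where "(U, \<phi>) \<in> A" "p \<in> U"
proof -
  have "p \<in> (\<Union>(U, \<phi>)\<in>A. U)" using smooth_atlas unfolding smooth_atlas_def by simp
  then show thesis using that by auto
qed

lemma chart_open_image:
  assumes "(U, \<phi>) \<in> A" "open S"
  shows "open (\<phi> ` (U \<inter> S))"
proof -
  have "\<phi> ` (U \<inter> S) = \<phi> ` U \<inter> inv_into U \<phi> -` S" using chart_inv[OF assms(1)] by auto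
  then show ?thesis
    using continuous_open_preimage[OF chart_inv_cont[OF assms(1)] chart_open_range[OF assms(1)] assms(2)]
    by simp
qed

lemma chart_open_vimage: "(U, \<phi>) \<in> A \<Longrightarrow> open T \<Longrightarrow> open (U \<inter> \<phi> -` T)"
  by (intro continuous_open_preimage chart_cont chart_open)

text \<open>Smoothness in one chart passes to all others because transition maps are smooth; the
  neighbourhood is shrunk to the preimage of \<open>T\<close>.\<close>

lemma smooth_near_chart:
  assumes "(U, \<phi>) \<in> A" "p \<in> U"
  shows "smooth_near A p f \<longleftrightarrow> (\<exists>T. open T \<and> \<phi> p \<in> T \<and> T \<subseteq> \<phi> ` U \<and> smooth_on T (f \<circ> inv_into U \<phi>))"
proof
  assume "smooth_near A p f"
  then obtain S where S: "open S" "p \<in> S" "smooth_fun_on A S f" unfolding smooth_near_def by auto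
  show "\<exists>T. open T \<and> \<phi> p \<in> T \<and> T \<subseteq> \<phi> ` U \<and> smooth_on T (f \<circ> inv_into U \<phi>)"
    by (rule exI[of _ "\<phi> ` (U \<inter> S)"])
      (use S assms chart_open_image[OF assms(1) S(1)] in \<open>auto simp: smooth_fun_on_def\<close>)
next
  assume "\<exists>T. open T \<and> \<phi> p \<in> T \<and> T \<subseteq> \<phi> ` U \<and> smooth_on T (f \<circ> inv_into U \<phi>)"
  then obtain T where T: "open T" "\<phi> p \<in> T" "smooth_on T (f \<circ> inv_into U \<phi>)" by auto
  define S where "S = U \<inter> \<phi> -` T"
  have S: "open S" "p \<in> S" using chart_open_vimage[OF assms(1) T(1)] T assms by (auto simp: S_def)
  have "smooth_on (\<psi> ` (V \<inter> S)) (f \<circ> inv_into V \<psi>)" if V: "(V, \<psi>) \<in> A" for V \<psi>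
  proof -
    have o: "open (\<psi> ` (V \<inter> S))" by (rule chart_open_image[OF V S(1)])
    have "smooth_on (\<psi> ` (V \<inter> S)) (\<lambda>x. (f \<circ> inv_into U \<phi>) ((\<phi> \<circ> inv_into V \<psi>) x))"
    proof (rule smooth_on_compose[OF T(3) _ o T(1)])
      show "smooth_on (\<psi> ` (V \<inter> S)) (\<phi> \<circ> inv_into V \<psi>)"
        by (rule smooth_on_subset[OF transition_smooth[OF V assms(1)]]) (auto simp: S_def)
      show "(\<phi> \<circ> inv_into V \<psi>) ` \<psi> ` (V \<inter> S) \<subseteq> T"
        using chart_inv[OF V] by (auto simp: S_def)
    qed
    then show ?thesis
      by (rule smooth_on_cong[OF _ o]) (auto simp: S_def chart_inv[OF V] chart_inv[OF assms(1)])
  qed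
  then show "smooth_near A p f" unfolding smooth_near_def smooth_fun_on_def using S by auto
qed

lemma smooth_near_nbhd:
  "smooth_near A p f \<Longrightarrow> \<exists>S. open S \<and> p \<in> S \<and> (\<forall>q\<in>S. smooth_near A q f)"
  unfolding smooth_near_def by blast

lemma smooth_fun_on_iff:
  assumes "open S"
  shows "smooth_fun_on A S f \<longleftrightarrow> (\<forall>p\<in>S. smooth_near A p f)"
proof
  assume *: "\<forall>p\<in>S. smooth_near A p f"
  have "smooth_on (\<phi> ` (U \<inter> S)) (f \<circ> inv_into U \<phi>)" if "(U, \<phi>) \<in> A" for U \<phi>
    by (rule smooth_on_local) (use * smooth_near_chart[OF that] in blast)
  then show "smooth_fun_on A S f" unfolding smooth_fun_on_def by auto
qed (use assms in \<open>auto simp: smooth_near_def\<close>)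

lemma smooth_near_cong:
  assumes "smooth_near A p f" "open S" "p \<in> S" "\<And>q. q \<in> S \<Longrightarrow> f q = g q"
  shows "smooth_near A p g"
proof -
  obtain U \<phi> where U: "(U, \<phi>) \<in> A" "p \<in> U" by (rule chart_at)
  obtain T where T: "open T" "\<phi> p \<in> T" "T \<subseteq> \<phi> ` U" "smooth_on T (f \<circ> inv_into U \<phi>)"
    using assms(1) smooth_near_chart[OF U] by auto
  have o: "open (T \<inter> \<phi> ` (U \<inter> S))" using T(1) chart_open_image[OF U(1) assms(2)] by auto
  have "smooth_on (T \<inter> \<phi> ` (U \<inter> S)) (g \<circ> inv_into U \<phi>)"
    by (rule smooth_on_cong[OF smooth_on_subset[OF T(4)] o]) (auto simp: chart_inv[OF U(1)] assms(4))
  then show ?thesis using smooth_near_chart[OF U] o T U(2) assms(3) by blast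
qed

lemma smooth_near_const: "smooth_near A p (\<lambda>q. c)"
proof -
  obtain U \<phi> where U: "(U, \<phi>) \<in> A" "p \<in> U" by (rule chart_at)
  then show ?thesis unfolding smooth_near_chart[OF U]
    by (intro exI[of _ "\<phi> ` U"]) (auto simp: o_def intro!: smooth_on_const chart_open_range[OF U(1)])
qed

lemma smooth_near_binop:
  assumes "smooth_near A p f" "smooth_near A p g"
    "\<And>T (a :: 'e \<Rightarrow> real) b. open T \<Longrightarrow> smooth_on T a \<Longrightarrow> smooth_on T b \<Longrightarrow> smooth_on T (\<lambda>x. h (a x) (b x))"
  shows "smooth_near A p (\<lambda>q. h (f q) (g q))"
proof -
  obtain U \<phi> where U: "(U, \<phi>) \<in> A" "p \<in> U" by (rule chart_at)
  obtain S where S: "open S" "\<phi> p \<in> S" "S \<subseteq> \<phi> ` U" "smooth_on S (f \<circ> inv_into U \<phi>)"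
    using assms(1) smooth_near_chart[OF U] by auto
  obtain T where T: "open T" "\<phi> p \<in> T" "T \<subseteq> \<phi> ` U" "smooth_on T (g \<circ> inv_into U \<phi>)"
    using assms(2) smooth_near_chart[OF U] by auto
  have "smooth_on (S \<inter> T) (\<lambda>x. h ((f \<circ> inv_into U \<phi>) x) ((g \<circ> inv_into U \<phi>) x))"
    using S(1) T(1) by (intro assms(3) smooth_on_subset[OF S(4)] smooth_on_subset[OF T(4)]) auto
  then show ?thesis unfolding smooth_near_chart[OF U]
    using S T by (intro exI[of _ "S \<inter> T"]) (auto simp: o_def)
qed

lemma smooth_near_add:
  "smooth_near A p f \<Longrightarrow> smooth_near A p g \<Longrightarrow> smooth_near A p (\<lambda>q. f q + g q)"
  by (rule smooth_near_binop) (auto intro: smooth_on_add)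

lemma smooth_near_mult:
  "smooth_near A p f \<Longrightarrow> smooth_near A p g \<Longrightarrow> smooth_near A p (\<lambda>q. f q * g q)"
  by (rule smooth_near_binop) (auto intro: smooth_on_bilinear[OF bounded_bilinear_mult])

lemma smooth_near_cmult: "smooth_near A p f \<Longrightarrow> smooth_near A p (\<lambda>q. c * f q)"
  by (intro smooth_near_mult smooth_near_const)

lemma smooth_near_diff:
  "smooth_near A p f \<Longrightarrow> smooth_near A p g \<Longrightarrow> smooth_near A p (\<lambda>q. f q - g q)"
  using smooth_near_add[OF _ smooth_near_cmult[of p g "-1"]] by simp

lemma smooth_near_sum:
  "(\<And>i. i \<in> I \<Longrightarrow> smooth_near A p (f i)) \<Longrightarrow> smooth_near A p (\<lambda>q. \<Sum>i\<in>I. f i q)"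
  by (induction I rule: infinite_finite_induct) (auto intro: smooth_near_add smooth_near_const)

lemma smooth_near_coordinate:
  assumes U: "(U, \<phi>) \<in> A" "p \<in> U"
  shows "smooth_near A p (\<lambda>q. \<phi> q \<bullet> b)"
proof -
  have o: "open (\<phi> ` U)" by (rule chart_open_range[OF U(1)])
  have "smooth_on (\<phi> ` U) (\<lambda>x. x \<bullet> b)"
    by (rule smooth_on_bounded_linear[OF bounded_linear_inner_left o smooth_on_id[OF o]])
  then have "smooth_on (\<phi> ` U) ((\<lambda>q. \<phi> q \<bullet> b) \<circ> inv_into U \<phi>)"
    by (rule smooth_on_cong[OF _ o]) (auto simp: chart_inv[OF U(1)])
  then show ?thesis unfolding smooth_near_chart[OF U] using o U by blast
qed

lemma smooth_near_has_derivative: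
  assumes "(U, \<phi>) \<in> A" "p \<in> U" "smooth_near A p f"
  shows "(f \<circ> inv_into U \<phi> has_derivative frechet_derivative (f \<circ> inv_into U \<phi>) (at (\<phi> p))) (at (\<phi> p))"
proof -
  obtain T where "smooth_on T (f \<circ> inv_into U \<phi>)" "\<phi> p \<in> T"
    using assms(3) smooth_near_chart[OF assms(1,2)] by auto
  then show ?thesis by (rule smooth_on_has_derivative)
qed

text \<open>Near 0, \<open>f \<circ> \<gamma>\<close> factors as \<open>(f \<circ> inv_into U
  \<phi>) \<circ> (\<phi> \<circ> \<gamma>)\<close>. By the chain rule only the coordinate velocity
  \<open>D 1\<close> of the curve survives.\<close>

lemma velocity_eq_chart_vec:
  assumes "smooth_curve A \<epsilon> \<gamma>" "\<epsilon> > 0" "(U, \<phi>) \<in> A" "\<gamma> 0 \<in> U"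
    "(\<phi> \<circ> \<gamma> has_derivative D) (at 0)"
  shows "velocity A \<gamma> = chart_vec A U \<phi> (\<gamma> 0) (D 1)"
proof (rule ext)
  fix f
  have "deriv (f \<circ> \<gamma>) 0 = frechet_derivative (f \<circ> inv_into U \<phi>) (at (\<phi> (\<gamma> 0))) (D 1)"
    if f: "smooth_near A (\<gamma> 0) f"
  proof -
    let ?F = "f \<circ> inv_into U \<phi>"
    let ?F' = "frechet_derivative ?F (at (\<phi> (\<gamma> 0)))"
    let ?S = "{-\<epsilon><..<\<epsilon>} \<inter> \<gamma> -` U"
    have F: "(?F has_derivative ?F') (at (\<phi> (\<gamma> 0)))"
      by (rule smooth_near_has_derivative[OF assms(3,4) f])
    have S: "open ?S" using assms(1) chart_open[OF assms(3)]
      by (auto simp: smooth_curve_def intro!: continuous_open_preimage)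
    have "(?F \<circ> (\<phi> \<circ> \<gamma>) has_derivative ?F' \<circ> D) (at 0)"
      by (rule diff_chain_at[OF assms(5)]) (use F in simp)
    then have "(f \<circ> \<gamma> has_derivative ?F' \<circ> D) (at 0)"
      by (rule has_derivative_transform_within_open[OF _ S])
        (use assms in \<open>auto simp: chart_inv[OF assms(3)]\<close>)
    moreover have "?F' \<circ> D = (*) (?F' (D 1))"
    proof
      fix t :: real
      have "D t = t *\<^sub>R D 1"
        using linear_scale[OF has_derivative_linear[OF assms(5)], of t 1] by simp
      then show "(?F' \<circ> D) t = ?F' (D 1) * t"
        using linear_scale[OF has_derivative_linear[OF F], of t "D 1"] by simp
    qed
    ultimately show ?thesis by (intro DERIV_imp_deriv) (simp add: has_field_derivative_def)
  qed
  then show "velocity A \<gamma> f = chart_vec A U \<phi> (\<gamma> 0) (D 1) f"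
    unfolding velocity_def chart_vec_def by simp
qed

lemma tangent_space_eq:
  assumes U: "(U, \<phi>) \<in> A" "p \<in> U"
  shows "tangent_space A p = range (chart_vec A U \<phi> p)"
proof safe
  fix u assume "u \<in> tangent_space A p"
  then obtain \<gamma> \<epsilon> where u: "u = velocity A \<gamma>" "\<epsilon> > 0" "smooth_curve A \<epsilon> \<gamma>" "\<gamma> 0 = p"
    unfolding tangent_space_def by auto
  have "smooth_on {t \<in> {-\<epsilon><..<\<epsilon>}. \<gamma> t \<in> U} (\<phi> \<circ> \<gamma>)"
    using u(3) U unfolding smooth_curve_def by auto
  from smooth_on_has_derivative[OF this, of 0] u U
  have "(\<phi> \<circ> \<gamma> has_derivative frechet_derivative (\<phi> \<circ> \<gamma>) (at 0)) (at 0)" by auto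
  from velocity_eq_chart_vec[OF u(3,2) U(1) _ this] u U
  show "u \<in> range (chart_vec A U \<phi> p)" by auto
next
  fix v
  \<comment> \<open>The coordinate straight line with velocity \<open>v\<close> realises every
    vector; \<epsilon> will keep it inside the range of the chart.\<close>
  define c where "c = (\<lambda>t. \<phi> p + t *\<^sub>R v)"
  define \<gamma> where "\<gamma> = inv_into U \<phi> \<circ> c"
  have c: "smooth_on S c" if "open S" for S
    unfolding c_def by (intro smooth_on_add smooth_on_const that
        smooth_on_bounded_linear[OF bounded_linear_scaleR_left] smooth_on_id)
  have "open (c -` (\<phi> ` U))" using chart_open_range[OF U(1)]
    by (intro open_vimage) (auto simp: c_def intro!: continuous_intros)
  moreover have "0 \<in> c -` (\<phi> ` U)" using U by (auto simp: c_def)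
  ultimately obtain \<epsilon> where e: "\<epsilon> > 0" "ball 0 \<epsilon> \<subseteq> c -` (\<phi> ` U)" by (metis openE)
  have e': "c t \<in> \<phi> ` U" if "t \<in> {-\<epsilon><..<\<epsilon>}" for t using e(2) that by (auto simp: subset_iff)
  have cg: "continuous_on {-\<epsilon><..<\<epsilon>} \<gamma>"
    unfolding \<gamma>_def
    by (intro continuous_on_compose smooth_on_continuous_on[OF c] continuous_on_subset[OF chart_inv_cont[OF U(1)]])
      (use e' in auto)
  have "smooth_on {t \<in> {-\<epsilon><..<\<epsilon>}. \<gamma> t \<in> V} (\<psi> \<circ> \<gamma>)" if V: "(V, \<psi>) \<in> A" for V \<psi>
  proof -
    have "{t \<in> {-\<epsilon><..<\<epsilon>}. \<gamma> t \<in> V} = {-\<epsilon><..<\<epsilon>} \<inter> \<gamma> -` V" by auto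
    then have o: "open {t \<in> {-\<epsilon><..<\<epsilon>}. \<gamma> t \<in> V}"
      using continuous_open_preimage[OF cg _ chart_open[OF V]] by simp
    have "smooth_on {t \<in> {-\<epsilon><..<\<epsilon>}. \<gamma> t \<in> V} (\<lambda>t. (\<psi> \<circ> inv_into U \<phi>) (c t))"
      by (rule smooth_on_compose[OF transition_smooth[OF U(1) V] c[OF o] o
            chart_open_image[OF U(1) chart_open[OF V]]])
        (use e' chart_inv[OF U(1)] in \<open>force simp: \<gamma>_def\<close>)
    then show ?thesis by (simp add: \<gamma>_def o_def)
  qed
  then have g: "smooth_curve A \<epsilon> \<gamma>" unfolding smooth_curve_def using cg by auto
  have g0: "\<gamma> 0 = p" using U by (simp add: \<gamma>_def c_def chart_inv[OF U(1)])
  have "(c has_derivative (\<lambda>t. t *\<^sub>R v)) (at 0)"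
    unfolding c_def by (auto intro!: derivative_eq_intros)
  then have "(\<phi> \<circ> \<gamma> has_derivative (\<lambda>t. t *\<^sub>R v)) (at 0)"
    by (rule has_derivative_transform_within_open[of _ _ _ _ "{-\<epsilon><..<\<epsilon>}"])
      (use e(1) e' in \<open>auto simp: \<gamma>_def f_inv_into_f\<close>)
  from velocity_eq_chart_vec[OF g e(1) U(1) _ this] g0 U
  have "chart_vec A U \<phi> p v = velocity A \<gamma>" by simp
  then show "chart_vec A U \<phi> p v \<in> tangent_space A p"
    unfolding tangent_space_def using e(1) g g0 by blast
qed

lemma chart_vec_coordinate:
  assumes U: "(U, \<phi>) \<in> A" "p \<in> U"
  shows "chart_vec A U \<phi> p v (\<lambda>q. \<phi> q \<bullet> b) = v \<bullet> b"
proof -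
  have "((\<lambda>x. x \<bullet> b) has_derivative (\<lambda>v. v \<bullet> b)) (at (\<phi> p))"
    by (auto intro!: derivative_eq_intros)
  then have "((\<lambda>q. \<phi> q \<bullet> b) \<circ> inv_into U \<phi> has_derivative (\<lambda>v. v \<bullet> b)) (at (\<phi> p))"
    by (rule has_derivative_transform_within_open[OF _ chart_open_range[OF U(1)]])
      (use U in \<open>auto simp: f_inv_into_f chart_inv\<close>)
  from frechet_derivative_at[OF this]
  show ?thesis using smooth_near_coordinate[OF U] by (metis chart_vec_def)
qed

lemma inj_chart_vec:
  assumes U: "(U, \<phi>) \<in> A" "p \<in> U"
  shows "inj (chart_vec A U \<phi> p)"
proof (rule injI, rule euclidean_eqI)
  fix v w b
  assume "chart_vec A U \<phi> p v = chart_vec A U \<phi> p w"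
  then show "v \<bullet> b = w \<bullet> b"
    using chart_vec_coordinate[OF U, of v b] chart_vec_coordinate[OF U, of w b] by simp
qed

lemma chart_vec_linear:
  assumes U: "(U, \<phi>) \<in> A" "p \<in> U"
  shows "chart_vec A U \<phi> p (v + w) = chart_vec A U \<phi> p v + chart_vec A U \<phi> p w"
    and "chart_vec A U \<phi> p (c *\<^sub>R v) = tscale c (chart_vec A U \<phi> p v)"
  by (auto simp: chart_vec_def tscale_def fun_eq_iff
      linear_add[OF has_derivative_linear[OF smooth_near_has_derivative[OF U]]]
      linear_scale[OF has_derivative_linear[OF smooth_near_has_derivative[OF U]]])

text \<open>Curves cannot be added; closure is inherited from the linear parametrisation of the
  tangent space by one chart.\<close>

lemma tangent_add:
  assumes "u \<in> tangent_space A p" "v \<in> tangent_space A p"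
  shows "u + v \<in> tangent_space A p"
proof -
  obtain U \<phi> where U: "(U, \<phi>) \<in> A" "p \<in> U" by (rule chart_at)
  show ?thesis using assms unfolding tangent_space_eq[OF U]
    by (auto simp: chart_vec_linear(1)[OF U, symmetric])
qed

lemma tangent_tscale:
  assumes "u \<in> tangent_space A p"
  shows "tscale c u \<in> tangent_space A p"
proof -
  obtain U \<phi> where U: "(U, \<phi>) \<in> A" "p \<in> U" by (rule chart_at)
  show ?thesis using assms unfolding tangent_space_eq[OF U]
    by (auto simp: chart_vec_linear(2)[OF U, symmetric])
qed

context
  fixes p u
  assumes u: "u \<in> tangent_space A p"
begin

lemma tangent_not_smooth: "\<not> smooth_near A p f \<Longrightarrow> u f = 0"
  using u unfolding tangent_space_def velocity_def by auto

lemma tangent_chart_rep: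
  obtains U \<phi> w where "(U, \<phi>) \<in> A" "p \<in> U" "u = chart_vec A U \<phi> p w"
proof -
  obtain U \<phi> where U: "(U, \<phi>) \<in> A" "p \<in> U" by (rule chart_at)
  show thesis using u that U unfolding tangent_space_eq[OF U] by auto
qed

lemma tangent_apply_add:
  assumes "smooth_near A p f" "smooth_near A p g"
  shows "u (\<lambda>q. f q + g q) = u f + u g"
proof -
  obtain U \<phi> w where U: "(U, \<phi>) \<in> A" "p \<in> U" "u = chart_vec A U \<phi> p w"
    by (rule tangent_chart_rep)
  from frechet_derivative_at[OF has_derivative_add[OF smooth_near_has_derivative[OF U(1,2) assms(1)]
        smooth_near_has_derivative[OF U(1,2) assms(2)]]]
  show ?thesis using assms smooth_near_add[OF assms] by (simp add: chart_vec_def U(3) o_def fun_eq_iff)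
qed

lemma tangent_apply_mult:
  assumes "smooth_near A p f" "smooth_near A p g"
  shows "u (\<lambda>q. f q * g q) = f p * u g + u f * g p"
proof -
  obtain U \<phi> w where U: "(U, \<phi>) \<in> A" "p \<in> U" "u = chart_vec A U \<phi> p w"
    by (rule tangent_chart_rep)
  from frechet_derivative_at[OF has_derivative_mult[OF smooth_near_has_derivative[OF U(1,2) assms(1)]
        smooth_near_has_derivative[OF U(1,2) assms(2)]]]
  show ?thesis using assms smooth_near_mult[OF assms]
    by (simp add: chart_vec_def U o_def fun_eq_iff chart_inv[OF U(1)])
qed

lemma tangent_apply_const: "u (\<lambda>q. c) = 0"
proof -
  obtain U \<phi> w where U: "(U, \<phi>) \<in> A" "p \<in> U" "u = chart_vec A U \<phi> p w"
    by (rule tangent_chart_rep)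
  from frechet_derivative_at[OF has_derivative_const[of c "at (\<phi> p)"]]
  show ?thesis by (simp add: chart_vec_def U o_def fun_eq_iff smooth_near_const)
qed

lemma tangent_apply_cmult: "smooth_near A p f \<Longrightarrow> u (\<lambda>q. c * f q) = c * u f"
  using tangent_apply_mult[OF smooth_near_const, of f c] tangent_apply_const by simp

lemma tangent_apply_diff:
  "smooth_near A p f \<Longrightarrow> smooth_near A p g \<Longrightarrow> u (\<lambda>q. f q - g q) = u f - u g"
  using tangent_apply_add[OF _ smooth_near_cmult, of f g "-1"] tangent_apply_cmult[of g "-1"] by simp

lemma tangent_apply_sum:
  "(\<And>i. i \<in> I \<Longrightarrow> smooth_near A p (f i)) \<Longrightarrow> u (\<lambda>q. \<Sum>i\<in>I. f i q) = (\<Sum>i\<in>I. u (f i))"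
  by (induction I rule: infinite_finite_induct)
    (auto simp: tangent_apply_const tangent_apply_add smooth_near_sum)

text \<open>Derivatives are local. The smoothness of \<open>f\<close> and \<open>g\<close> has to be
  compared as well, since it selects the branch of \<open>chart_vec\<close>.\<close>

lemma tangent_apply_cong:
  assumes "open S" "p \<in> S" "\<And>q. q \<in> S \<Longrightarrow> f q = g q"
  shows "u f = u g"
proof -
  obtain U \<phi> w where U: "(U, \<phi>) \<in> A" "p \<in> U" "u = chart_vec A U \<phi> p w"
    by (rule tangent_chart_rep)
  have "frechet_derivative (f \<circ> inv_into U \<phi>) (at (\<phi> p)) = frechet_derivative (g \<circ> inv_into U \<phi>) (at (\<phi> p))"
    by (rule frechet_derivative_cong_open[OF chart_open_image[OF U(1) assms(1)]])
      (use U assms in \<open>auto simp: chart_inv[OF U(1)]\<close>)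
  moreover have "smooth_near A p f \<longleftrightarrow> smooth_near A p g"
    using smooth_near_cong[of p f S g] smooth_near_cong[of p g S f] assms by auto
  ultimately show ?thesis by (simp add: U chart_vec_def)
qed

end

end

section \<open>Left translations and left invariant frames\<close>

text \<open>Joint smoothness, tested in products of two charts. Quantifying over all charts around
  \<open>p\<close> and \<open>q\<close> lets later proofs choose charts freely.\<close>

definition smooth_near2 ::
  "('g::topological_space, 'e::euclidean_space) atlas \<Rightarrow> 'g \<Rightarrow> 'g \<Rightarrow> ('g \<Rightarrow> 'g \<Rightarrow> real) \<Rightarrow> bool" where
  "smooth_near2 A p q F \<longleftrightarrow> (\<forall>U \<phi> V \<psi>. (U, \<phi>) \<in> A \<longrightarrow> (V, \<psi>) \<in> A \<longrightarrow> p \<in> U \<longrightarrow> q \<in> V \<longrightarrow>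
     (\<exists>T. open T \<and> (\<phi> p, \<psi> q) \<in> T \<and> T \<subseteq> \<phi> ` U \<times> \<psi> ` V \<and>
       smooth_on T (\<lambda>z. F (inv_into U \<phi> (fst z)) (inv_into V \<psi> (snd z)))))"

text \<open>The linear part of \<open>lie_algebra_iso\<close>, without the bracket. The coordinate
  space \<open>'v\<close> stays arbitrary so that a linear bijection can replace it, for instance by
  pairs of complex numbers.\<close>

definition left_frame ::
  "('g::{topological_group_add, t2_space, second_countable_topology}, 'e::euclidean_space) atlas
     \<Rightarrow> ('v::real_vector \<Rightarrow> 'g vfield) \<Rightarrow> bool" where
  "left_frame A \<Phi> \<longleftrightarrow> bij_betw \<Phi> UNIV (lie_algebra A) \<and>
     (\<forall>x y. \<Phi> (x + y) = \<Phi> x + \<Phi> y) \<and>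
     (\<forall>c x. \<Phi> (c *\<^sub>R x) = fscale (\<lambda>_. c) (\<Phi> x))"

section \<open>Differentiating jointly smooth functions in one variable\<close>

context smooth_mfd
begin

lemma smooth_near2D:
  assumes "smooth_near2 A p q F" "(U, \<phi>) \<in> A" "(V, \<psi>) \<in> A" "p \<in> U" "q \<in> V"
  obtains T where "open T" "(\<phi> p, \<psi> q) \<in> T" "T \<subseteq> \<phi> ` U \<times> \<psi> ` V"
    "smooth_on T (\<lambda>z. F (inv_into U \<phi> (fst z)) (inv_into V \<psi> (snd z)))"
  using assms(1)[unfolded smooth_near2_def, rule_format, OF assms(2-5)] by (elim exE conjE) (rule that)

text \<open>\<open>H w\<close> is the derivative of the coordinate expression in the direction
  \<open>(0, w)\<close>, hence again smooth in both variables. Every later smooth dependence on a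
  group element rests on this.\<close>

lemma smooth_near2_deriv:
  assumes F: "smooth_near2 A p q F" and U: "(U, \<phi>) \<in> A" "p \<in> U" and V: "(V, \<psi>) \<in> A" "q \<in> V"
  obtains T H where "open T" "(\<phi> p, \<psi> q) \<in> T" "\<And>w. smooth_on T (H w)"
    "\<And>a b. a \<in> U \<Longrightarrow> b \<in> V \<Longrightarrow> (\<phi> a, \<psi> b) \<in> T \<Longrightarrow> smooth_near A b (F a)"
    "\<And>a b w. a \<in> U \<Longrightarrow> b \<in> V \<Longrightarrow> (\<phi> a, \<psi> b) \<in> T \<Longrightarrow> chart_vec A V \<psi> b w (F a) = H w (\<phi> a, \<psi> b)"
proof -
  define G where "G = (\<lambda>z. F (inv_into U \<phi> (fst z)) (inv_into V \<psi> (snd z)))"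
  obtain T where T: "open T" "(\<phi> p, \<psi> q) \<in> T" "T \<subseteq> \<phi> ` U \<times> \<psi> ` V" "smooth_on T G"
    unfolding G_def by (rule smooth_near2D[OF F U(1) V(1) U(2) V(2)])
  have sm: "smooth_near A b (F a)" if "a \<in> U" "b \<in> V" "(\<phi> a, \<psi> b) \<in> T" for a b
  proof -
    let ?S = "{y. (\<phi> a, y) \<in> T}"
    have o: "open ?S"
      using open_vimage[OF T(1) continuous_on_Pair, of "\<lambda>y. \<phi> a" "\<lambda>y. y"] by (auto simp: vimage_def)
    have "smooth_on ?S (\<lambda>y. G (\<phi> a, y))"
      by (rule smooth_on_compose[OF T(4) smooth_on_Pair[OF o smooth_on_const[OF o] smooth_on_id[OF o]] o T(1)])
        auto
    then have "smooth_on ?S (F a \<circ> inv_into V \<psi>)"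
      by (simp add: G_def o_def chart_inv[OF U(1) that(1)])
    then show ?thesis
      unfolding smooth_near_chart[OF V(1) that(2)] using o that T(3) by (intro exI[of _ ?S]) auto
  qed
  have "chart_vec A V \<psi> b w (F a) = frechet_derivative G (at (\<phi> a, \<psi> b)) (0, w)"
    if ab: "a \<in> U" "b \<in> V" "(\<phi> a, \<psi> b) \<in> T" for a b w
  proof -
    have "((\<lambda>y. (\<phi> a, y)) has_derivative (\<lambda>w. (0, w))) (at (\<psi> b))"
      by (auto intro!: derivative_eq_intros)
    from diff_chain_at[OF this smooth_on_has_derivative[OF T(4) ab(3)]]
    have "(F a \<circ> inv_into V \<psi> has_derivative (\<lambda>w. frechet_derivative G (at (\<phi> a, \<psi> b)) (0, w))) (at (\<psi> b))"
      by (simp add: G_def o_def chart_inv[OF U(1) ab(1)])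
    from frechet_derivative_at[OF this] show ?thesis
      using sm[OF ab] by (simp add: chart_vec_def fun_eq_iff)
  qed
  from that[OF T(1,2) _ sm this] show thesis using smooth_on_frechet_derivative[OF T(4)] by blast
qed

lemma smooth_near2_right: "smooth_near2 A p q F \<Longrightarrow> smooth_near A q (F p)"
  by (metis chart_at smooth_near2_deriv)

lemma smooth_near_chart_comp:
  assumes U: "(U, \<phi>) \<in> A" "p \<in> U" and "open T" "\<phi> p \<in> T" "smooth_on T h"
  shows "smooth_near A p (\<lambda>a. h (\<phi> a))"
proof -
  have o: "open (T \<inter> \<phi> ` U)" using assms(3) chart_open_range[OF U(1)] by auto
  have "smooth_on (T \<inter> \<phi> ` U) ((\<lambda>a. h (\<phi> a)) \<circ> inv_into U \<phi>)"
    by (rule smooth_on_cong[OF smooth_on_subset[OF assms(5)] o]) (auto simp: chart_inv[OF U(1)])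
  then show ?thesis unfolding smooth_near_chart[OF U] using o assms by blast
qed

lemma smooth_near_tangent_apply:
  assumes F: "smooth_near2 A p q F" and v: "v \<in> tangent_space A q"
  shows "smooth_near A p (\<lambda>a. v (F a))"
proof -
  obtain V \<psi> w where V: "(V, \<psi>) \<in> A" "q \<in> V" "v = chart_vec A V \<psi> q w"
    by (rule tangent_chart_rep[OF v])
  obtain U \<phi> where U: "(U, \<phi>) \<in> A" "p \<in> U" by (rule chart_at)
  from smooth_near2_deriv[OF F U V(1,2)] obtain T H where T: "open T" "(\<phi> p, \<psi> q) \<in> T"
    "smooth_on T (H w)" "\<And>a. a \<in> U \<Longrightarrow> (\<phi> a, \<psi> q) \<in> T \<Longrightarrow> chart_vec A V \<psi> q w (F a) = H w (\<phi> a, \<psi> q)"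
    using V(2) by metis
  let ?S = "{x. (x, \<psi> q) \<in> T}"
  have o: "open ?S"
    using open_vimage[OF T(1) continuous_on_Pair, of "\<lambda>x. x" "\<lambda>x. \<psi> q"] by (auto simp: vimage_def)
  have "smooth_on ?S (\<lambda>x. H w (x, \<psi> q))"
    by (rule smooth_on_compose[OF T(3) smooth_on_Pair[OF o smooth_on_id[OF o] smooth_on_const[OF o]] o T(1)])
      auto
  from smooth_near_chart_comp[OF U o _ this] T(2)
  have "smooth_near A p (\<lambda>a. H w (\<phi> a, \<psi> q))" by simp
  then show ?thesis
    by (rule smooth_near_cong[of _ _ "U \<inter> \<phi> -` ?S"])
      (use chart_open_vimage[OF U(1) o] U T V(3) in auto)
qed

lemma tangent_chart_expand:
  assumes U: "(U, \<phi>) \<in> A" "p \<in> U" and u: "u \<in> tangent_space A p"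
  shows "u f = (\<Sum>c\<in>Basis. u (\<lambda>q. \<phi> q \<bullet> c) * chart_vec A U \<phi> p c f)"
proof (cases "smooth_near A p f")
  case True
  from u obtain w where w: "u = chart_vec A U \<phi> p w" unfolding tangent_space_eq[OF U] by auto
  show ?thesis
    using has_derivative_sum_Basis[OF smooth_near_has_derivative[OF U True], of w] True
    by (simp add: w chart_vec_coordinate[OF U]) (simp add: chart_vec_def)
qed (use tangent_not_smooth[OF u] in \<open>simp add: chart_vec_def\<close>)

lemma vector_field_tangent: "X \<in> vector_fields A \<Longrightarrow> X p \<in> tangent_space A p"
  unfolding vector_fields_def by auto

lemma vector_fields_iff:
  "X \<in> vector_fields A \<longleftrightarrow> (\<forall>p. X p \<in> tangent_space A p) \<and>
     (\<forall>p f. smooth_near A p f \<longrightarrow> smooth_near A p (\<lambda>q. X q f))"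
proof -
  have "(\<forall>S f. open S \<longrightarrow> smooth_fun_on A S f \<longrightarrow> smooth_fun_on A S (\<lambda>p. X p f)) \<longleftrightarrow>
    (\<forall>p f. smooth_near A p f \<longrightarrow> smooth_near A p (\<lambda>q. X q f))" (is "?L \<longleftrightarrow> ?R")
  proof
    show "?L \<Longrightarrow> ?R" unfolding smooth_near_def by metis
    show "?R \<Longrightarrow> ?L" by (simp add: smooth_fun_on_iff)
  qed
  then show ?thesis unfolding vector_fields_def by simp
qed

lemma vector_field_smooth:
  "X \<in> vector_fields A \<Longrightarrow> smooth_near A p f \<Longrightarrow> smooth_near A p (\<lambda>q. X q f)"
  by (simp add: vector_fields_iff)

text \<open>The differentiated function varies with the base point, so smoothness of
  \<open>X\<close> does not apply directly. Expanding \<open>X\<close> over coordinate vectors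
  separates its smooth components from partial derivatives of \<open>F\<close>, which are smooth
  along the diagonal.\<close>

lemma smooth_near_vector_field_apply:
  assumes X: "X \<in> vector_fields A" and F: "smooth_near2 A p p F"
  shows "smooth_near A p (\<lambda>a. X a (F a))"
proof -
  obtain U \<phi> where U: "(U, \<phi>) \<in> A" "p \<in> U" by (rule chart_at)
  from smooth_near2_deriv[OF F U U] obtain T H where T: "open T" "(\<phi> p, \<phi> p) \<in> T"
    "\<And>w. smooth_on T (H w)"
    "\<And>a w. a \<in> U \<Longrightarrow> (\<phi> a, \<phi> a) \<in> T \<Longrightarrow> chart_vec A U \<phi> a w (F a) = H w (\<phi> a, \<phi> a)"
    by metis
  let ?S = "{x. (x, x) \<in> T}"
  have o: "open ?S"
    using open_vimage[OF T(1) continuous_on_Pair, of "\<lambda>x. x" "\<lambda>x. x"] by (auto simp: vimage_def)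
  have H: "smooth_near A p (\<lambda>a. H w (\<phi> a, \<phi> a))" for w
  proof (rule smooth_near_chart_comp[OF U o])
    show "smooth_on ?S (\<lambda>x. H w (x, x))"
      by (rule smooth_on_compose[OF T(3) smooth_on_Pair[OF o smooth_on_id[OF o] smooth_on_id[OF o]] o T(1)])
        auto
  qed (use T(2) in simp)
  have "smooth_near A p (\<lambda>a. \<Sum>c\<in>Basis. X a (\<lambda>r. \<phi> r \<bullet> c) * H c (\<phi> a, \<phi> a))"
    by (intro smooth_near_sum smooth_near_mult H vector_field_smooth[OF X] smooth_near_coordinate[OF U])
  then show ?thesis
  proof (rule smooth_near_cong[of _ _ "U \<inter> \<phi> -` ?S"])
    fix a assume a: "a \<in> U \<inter> \<phi> -` ?S"
    then have "X a (F a) = (\<Sum>c\<in>Basis. X a (\<lambda>r. \<phi> r \<bullet> c) * chart_vec A U \<phi> a c (F a))"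
      using tangent_chart_expand[OF U(1) _ vector_field_tangent[OF X]] by blast
    then show "(\<Sum>c\<in>Basis. X a (\<lambda>r. \<phi> r \<bullet> c) * H c (\<phi> a, \<phi> a)) = X a (F a)"
      using T(4) a by simp
  qed (use chart_open_vimage[OF U(1) o] U T in auto)
qed

end

locale lie_grp =
  fixes A :: "('g::{topological_group_add, t2_space, second_countable_topology}, 'e::euclidean_space) atlas"
  assumes lie: "lie_group A"

sublocale lie_grp \<subseteq> smooth_mfd
  using lie by unfold_locales (simp add: lie_group_def)

section \<open>Smooth group operations and left invariant fields\<close>

context lie_grp
begin

lemma smooth_near2_plus:
  assumes f: "smooth_near A (p + q) f"
  shows "smooth_near2 A p q (\<lambda>a b. f (a + b))"
  unfolding smooth_near2_def
proof (clarify)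
  fix U \<phi> V \<psi>
  assume U: "(U, \<phi>) \<in> A" "p \<in> U" and V: "(V, \<psi>) \<in> A" "q \<in> V"
  obtain W \<theta> where W: "(W, \<theta>) \<in> A" "p + q \<in> W" by (rule chart_at)
  obtain S where S: "open S" "\<theta> (p + q) \<in> S" "S \<subseteq> \<theta> ` W" "smooth_on S (f \<circ> inv_into W \<theta>)"
    using f smooth_near_chart[OF W] by auto
  define m where "m = (\<lambda>z. inv_into U \<phi> (fst z) + inv_into V \<psi> (snd z))"
  define D where "D = {(x, y). x \<in> \<phi> ` U \<and> y \<in> \<psi> ` V \<and> inv_into U \<phi> x + inv_into V \<psi> y \<in> W}"
  have "smooth_on D (\<lambda>(x, y). \<theta> (inv_into U \<phi> x + inv_into V \<psi> y))"
    using lie U(1) V(1) W(1) unfolding lie_group_def D_def by blast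
  then have sm: "smooth_on D (\<lambda>z. \<theta> (m z))" by (simp add: m_def case_prod_unfold)
  have "continuous_on (\<phi> ` U \<times> \<psi> ` V) m"
    unfolding m_def
    by (intro continuous_on_add continuous_on_compose2[OF chart_inv_cont[OF U(1)]]
        continuous_on_compose2[OF chart_inv_cont[OF V(1)]]) (auto intro!: continuous_intros)
  define T where "T = (\<phi> ` U \<times> \<psi> ` V) \<inter> m -` (W \<inter> \<theta> -` S)"
  have T: "open T" unfolding T_def
    by (rule continuous_open_preimage[OF \<open>continuous_on _ m\<close> _ chart_open_vimage[OF W(1) S(1)]])
      (intro open_Times chart_open_range[OF U(1)] chart_open_range[OF V(1)])
  have "T \<subseteq> D" by (auto simp: T_def D_def m_def)
  have "smooth_on T (\<lambda>z. (f \<circ> inv_into W \<theta>) (\<theta> (m z)))"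
    by (rule smooth_on_compose[OF S(4) smooth_on_subset[OF sm \<open>T \<subseteq> D\<close>] T S(1)]) (auto simp: T_def)
  then have "smooth_on T (\<lambda>z. f (m z))"
    by (rule smooth_on_cong[OF _ T]) (auto simp: T_def chart_inv[OF W(1)])
  moreover have "(\<phi> p, \<psi> q) \<in> T"
    using U V W S by (auto simp: T_def m_def chart_inv)
  ultimately show "\<exists>T. open T \<and> (\<phi> p, \<psi> q) \<in> T \<and> T \<subseteq> \<phi> ` U \<times> \<psi> ` V \<and>
      smooth_on T (\<lambda>z. f (inv_into U \<phi> (fst z) + inv_into V \<psi> (snd z)))"
    using T by (intro exI[of _ T]) (auto simp: m_def T_def)
qed

text \<open>Together with \<open>smooth_near2_plus\<close> this makes \<open>- a + r\<close>, the
  translation back to the identity, smooth in \<open>a\<close> and \<open>r\<close>;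
  \<open>coef_smooth\<close> depends on it.\<close>

lemma smooth_near2_uminus:
  assumes F: "smooth_near2 A (- p) q F"
  shows "smooth_near2 A p q (\<lambda>a b. F (- a) b)"
  unfolding smooth_near2_def
proof (clarify)
  fix U \<phi> V \<psi>
  assume U: "(U, \<phi>) \<in> A" "p \<in> U" and V: "(V, \<psi>) \<in> A" "q \<in> V"
  obtain N \<nu> where N: "(N, \<nu>) \<in> A" "- p \<in> N" by (rule chart_at)
  obtain S where S: "open S" "(\<nu> (- p), \<psi> q) \<in> S" "S \<subseteq> \<nu> ` N \<times> \<psi> ` V"
    "smooth_on S (\<lambda>z. F (inv_into N \<nu> (fst z)) (inv_into V \<psi> (snd z)))"
    by (rule smooth_near2D[OF F N(1) V(1) N(2) V(2)])
  define E where "E = {x \<in> \<phi> ` U. - inv_into U \<phi> x \<in> N}"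
  have sm: "smooth_on E (\<lambda>x. \<nu> (- inv_into U \<phi> x))"
    using lie U(1) N(1) unfolding lie_group_def E_def by blast
  have "E = \<phi> ` U \<inter> (\<lambda>x. - inv_into U \<phi> x) -` N" by (auto simp: E_def)
  then have E: "open E"
    using continuous_open_preimage[OF continuous_on_minus[OF chart_inv_cont[OF U(1)]]
        chart_open_range[OF U(1)] chart_open[OF N(1)]] by simp
  then have E2: "open (E \<times> UNIV)" by (simp add: open_Times)
  define h where "h = (\<lambda>z::'e \<times> 'e. (\<nu> (- inv_into U \<phi> (fst z)), snd z))"
  have h: "smooth_on (E \<times> UNIV) h" unfolding h_def
    by (intro smooth_on_Pair E2 smooth_on_compose[OF sm _ E2 E]
        smooth_on_bounded_linear[OF bounded_linear_fst] smooth_on_bounded_linear[OF bounded_linear_snd]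
        smooth_on_id) auto
  define T where "T = (E \<times> UNIV) \<inter> h -` S"
  have T: "open T" unfolding T_def
    by (rule continuous_open_preimage[OF smooth_on_continuous_on[OF h] E2 S(1)])
  have "smooth_on T (\<lambda>z. F (inv_into N \<nu> (fst (h z))) (inv_into V \<psi> (snd (h z))))"
    by (rule smooth_on_compose[OF S(4) smooth_on_subset[OF h] T S(1)]) (auto simp: T_def)
  then have "smooth_on T (\<lambda>z. F (- inv_into U \<phi> (fst z)) (inv_into V \<psi> (snd z)))"
    by (rule smooth_on_cong[OF _ T]) (auto simp: T_def h_def E_def chart_inv[OF N(1)])
  moreover have "(\<phi> p, \<psi> q) \<in> T"
    using U V N S by (auto simp: T_def h_def E_def chart_inv)
  moreover have "T \<subseteq> \<phi> ` U \<times> \<psi> ` V" using S(3) by (auto simp: T_def h_def E_def)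
  ultimately show "\<exists>T. open T \<and> (\<phi> p, \<psi> q) \<in> T \<and> T \<subseteq> \<phi> ` U \<times> \<psi> ` V \<and>
      smooth_on T (\<lambda>z. F (- inv_into U \<phi> (fst z)) (inv_into V \<psi> (snd z)))"
    using T by blast
qed

text \<open>A translation is smooth by freezing the first variable of the group operation, and its
  inverse is the translation by \<open>- a\<close>. This is why \<open>dleft\<close> respects the
  zero convention.\<close>

lemma smooth_near_translate: "smooth_near A (a + p) f \<longleftrightarrow> smooth_near A p (\<lambda>q. f (a + q))"
proof
  show "smooth_near A (a + p) f \<Longrightarrow> smooth_near A p (\<lambda>q. f (a + q))"
    using smooth_near2_right[OF smooth_near2_plus] .
  assume "smooth_near A p (\<lambda>q. f (a + q))"
  then have "smooth_near A (- a + (a + p)) (\<lambda>q. f (a + q))" by (simp add: add.assoc[symmetric])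
  from smooth_near2_right[OF smooth_near2_plus[OF this]]
  show "smooth_near A (a + p) f" by (simp add: add.assoc[symmetric])
qed

lemma dleft_dleft: "dleft a (dleft b u) = dleft (a + b) u"
  by (simp add: dleft_def add.assoc)

lemma dleft_0: "dleft 0 u = u"
  by (simp add: dleft_def)

lemma dleft_linear: "dleft a (u + v) = dleft a u + dleft a v" "dleft a (tscale c u) = tscale c (dleft a u)"
  by (auto simp: dleft_def tscale_def)

lemma dleft_tangent:
  assumes u: "u \<in> tangent_space A p"
  shows "dleft a u \<in> tangent_space A (a + p)"
proof -
  obtain U \<phi> w where U: "(U, \<phi>) \<in> A" "p \<in> U" and uw: "u = chart_vec A U \<phi> p w"
    by (rule tangent_chart_rep[OF u])
  obtain W \<theta> where W: "(W, \<theta>) \<in> A" "a + p \<in> W" by (rule chart_at)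
  define \<tau> where "\<tau> = (\<lambda>y. \<theta> (a + inv_into U \<phi> y))"
  \<comment> \<open>Only real functions are known to be smooth near \<open>p\<close>, so the
    derivative of the translation \<tau> is assembled from its components.\<close>
  define \<tau>' where "\<tau>' = (\<lambda>v. \<Sum>c\<in>Basis.
    frechet_derivative ((\<lambda>q. \<theta> (a + q) \<bullet> c) \<circ> inv_into U \<phi>) (at (\<phi> p)) v *\<^sub>R c)"
  have "smooth_near A p (\<lambda>q. \<theta> (a + q) \<bullet> c)" for c
    using smooth_near_coordinate[OF W, of c] smooth_near_translate[of a p "\<lambda>q. \<theta> q \<bullet> c"] by simp
  from smooth_near_has_derivative[OF U this]
  have "(\<tau> has_derivative \<tau>') (at (\<phi> p))"
    by (subst has_derivative_componentwise_within) (simp add: \<tau>_def \<tau>'_def o_def)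
  note t = this
  have "dleft a u f = chart_vec A W \<theta> (a + p) (\<tau>' w) f" for f
  proof (cases "smooth_near A (a + p) f")
    case True
    let ?S = "\<phi> ` (U \<inter> (\<lambda>q. a + q) -` W)"
    have "open ((\<lambda>q. a + q) -` W)"
      by (intro open_vimage chart_open[OF W(1)] continuous_intros)
    then have S: "open ?S" by (rule chart_open_image[OF U(1)])
    have "\<tau> (\<phi> p) = \<theta> (a + p)" by (simp add: \<tau>_def chart_inv[OF U])
    with diff_chain_at[OF t] smooth_near_has_derivative[OF W True]
    have "((f \<circ> inv_into W \<theta>) \<circ> \<tau> has_derivative
        frechet_derivative (f \<circ> inv_into W \<theta>) (at (\<theta> (a + p))) \<circ> \<tau>') (at (\<phi> p))" by simp
    then have "((\<lambda>q. f (a + q)) \<circ> inv_into U \<phi> has_derivative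
        frechet_derivative (f \<circ> inv_into W \<theta>) (at (\<theta> (a + p))) \<circ> \<tau>') (at (\<phi> p))"
      by (rule has_derivative_transform_within_open[OF _ S])
        (use U W in \<open>auto simp: \<tau>_def chart_inv\<close>)
    from frechet_derivative_at[OF this]
    show ?thesis using True smooth_near_translate[of a p f]
      by (simp add: dleft_def uw chart_vec_def fun_eq_iff)
  qed (use smooth_near_translate[of a p f] in \<open>simp add: dleft_def uw chart_vec_def\<close>)
  then have "dleft a u = chart_vec A W \<theta> (a + p) (\<tau>' w)" ..
  then show ?thesis using tangent_space_eq[OF W] by simp
qed

lemma left_field_in_lie_algebra:
  assumes v: "v \<in> tangent_space A 0"
  shows "(\<lambda>p. dleft p v) \<in> lie_algebra A"
proof -
  have "smooth_near A p (\<lambda>q. dleft q v f)" if "smooth_near A p f" for p f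
    using smooth_near_tangent_apply[OF smooth_near2_plus v, of p f] that by (simp add: dleft_def)
  then show ?thesis
    unfolding lie_algebra_def vector_fields_iff using dleft_tangent[OF v] by (auto simp: dleft_dleft)
qed

lemma lie_algebra_translate: "X \<in> lie_algebra A \<Longrightarrow> X (a + p) = dleft a (X p)"
  unfolding lie_algebra_def by auto

lemma lie_algebra_vector_field: "X \<in> lie_algebra A \<Longrightarrow> X \<in> vector_fields A"
  unfolding lie_algebra_def by auto

lemma lie_algebra_eq: "X \<in> lie_algebra A \<Longrightarrow> X q = dleft (q - p) (X p)"
  using lie_algebra_translate[of X "q - p" p] by simp

text \<open>Evaluation at the identity identifies left invariant fields with tangent vectors there,
  and a chart identifies these with the model space.\<close>

lemma left_frame_exists: "\<exists>\<Phi> :: 'e \<Rightarrow> 'g vfield. left_frame A \<Phi>"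
proof -
  obtain U \<phi> where U: "(U, \<phi>) \<in> A" "0 \<in> U" by (rule chart_at)
  define \<Phi> where "\<Phi> = (\<lambda>v p. dleft p (chart_vec A U \<phi> 0 v))"
  have "bij_betw \<Phi> UNIV (lie_algebra A)"
  proof (rule bij_betwI')
    fix x y
    have "x = y" if "\<Phi> x = \<Phi> y"
      using fun_cong[OF that, of 0] inj_chart_vec[OF U] by (simp add: \<Phi>_def dleft_0 inj_eq)
    then show "(\<Phi> x = \<Phi> y) = (x = y)" by auto
    show "\<Phi> x \<in> lie_algebra A" unfolding \<Phi>_def
      by (rule left_field_in_lie_algebra) (simp add: tangent_space_eq[OF U])
  next
    fix X assume X: "X \<in> lie_algebra A"
    then have "X 0 \<in> tangent_space A 0" by (intro vector_field_tangent lie_algebra_vector_field)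
    then obtain v where "X 0 = chart_vec A U \<phi> 0 v" unfolding tangent_space_eq[OF U] by auto
    then have "X q = \<Phi> v q" for q
      using lie_algebra_translate[OF X, of q 0] by (simp add: \<Phi>_def)
    then have "X = \<Phi> v" ..
    then show "\<exists>x\<in>UNIV. X = \<Phi> x" by auto
  qed
  moreover have "\<Phi> (x + y) = \<Phi> x + \<Phi> y" "\<Phi> (c *\<^sub>R x) = fscale (\<lambda>_. c) (\<Phi> x)" for x y c
    by (auto simp: \<Phi>_def chart_vec_linear[OF U] dleft_linear fscale_def)
  ultimately show ?thesis unfolding left_frame_def by blast
qed

end

section \<open>Coefficients with respect to a left invariant frame\<close>

locale framed = lie_grp A
  for A :: "('g::{topological_group_add, t2_space, second_countable_topology}, 'e::euclidean_space) atlas" +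
  fixes \<Phi> :: "'v::euclidean_space \<Rightarrow> 'g vfield"
  assumes frame: "left_frame A \<Phi>"
begin

text \<open>Inverse of evaluation of the frame at \<open>p\<close>, an injective map onto the
  tangent space; elsewhere the value is arbitrary.\<close>

definition coef :: "'g \<Rightarrow> 'g tvec \<Rightarrow> 'v" where
  "coef p = inv (\<lambda>x. \<Phi> x p)"

lemma frame_add: "\<Phi> (x + y) = \<Phi> x + \<Phi> y"
  and frame_scale: "\<Phi> (c *\<^sub>R x) = fscale (\<lambda>_. c) (\<Phi> x)"
  and frame_bij: "bij_betw \<Phi> UNIV (lie_algebra A)"
  using frame unfolding left_frame_def by auto

lemma frame_lie_algebra: "\<Phi> x \<in> lie_algebra A"
  using frame_bij by (auto simp: bij_betw_def)

lemma frame_vector_field: "\<Phi> x \<in> vector_fields A"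
  by (intro lie_algebra_vector_field frame_lie_algebra)

lemma frame_tangent: "\<Phi> x p \<in> tangent_space A p"
  by (intro vector_field_tangent frame_vector_field)

lemma frame_scale_at: "\<Phi> (c *\<^sub>R x) p = tscale c (\<Phi> x p)"
  by (simp add: frame_scale fscale_def)

lemma frame_add_at: "\<Phi> (x + y) p = \<Phi> x p + \<Phi> y p"
  by (simp add: frame_add)

lemma frame_sum_at: "finite I \<Longrightarrow> \<Phi> (\<Sum>i\<in>I. c i *\<^sub>R x i) p f = (\<Sum>i\<in>I. c i * \<Phi> (x i) p f)"
proof (induction I rule: finite_induct)
  case empty
  show ?case using frame_scale_at[of 0 0 p] by (simp add: tscale_def)
qed (simp add: frame_add_at frame_scale_at tscale_def)

lemma frame_expand: "\<Phi> x p f = (\<Sum>b\<in>Basis. (x \<bullet> b) * \<Phi> b p f)"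
  using frame_sum_at[of Basis "\<lambda>b. x \<bullet> b" "\<lambda>b. b" p f] by (simp add: euclidean_representation)

lemma frame_translate: "\<Phi> x (a + p) = dleft a (\<Phi> x p)"
  by (intro lie_algebra_translate frame_lie_algebra)

text \<open>Translation carries the equality from \<open>p\<close> to every other point, and \<Phi>
  is injective.\<close>

lemma frame_at_inj: "\<Phi> x p = \<Phi> y p \<Longrightarrow> x = y"
proof -
  assume *: "\<Phi> x p = \<Phi> y p"
  have "\<Phi> x = \<Phi> y"
  proof
    fix q
    show "\<Phi> x q = \<Phi> y q"
      using lie_algebra_eq[OF frame_lie_algebra[of x], of q p]
        lie_algebra_eq[OF frame_lie_algebra[of y], of q p] * by (simp only:)
  qed
  then show ?thesis using frame_bij by (auto simp: bij_betw_def inj_def)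
qed

lemma coef_frame: "coef p (\<Phi> x p) = x"
  unfolding coef_def by (rule inv_f_f) (auto intro!: injI dest: frame_at_inj)

lemma frame_coef:
  assumes "u \<in> tangent_space A p"
  shows "\<Phi> (coef p u) p = u"
proof -
  have "dleft (- p) u \<in> tangent_space A 0" using dleft_tangent[OF assms, of "- p"] by simp
  from left_field_in_lie_algebra[OF this] obtain x where "(\<lambda>q. dleft q (dleft (- p) u)) = \<Phi> x"
    using frame_bij by (auto simp: bij_betw_def)
  from fun_cong[OF this, of p] have "u = \<Phi> x p" by (simp add: dleft_dleft dleft_0)
  then show ?thesis by (simp add: coef_frame)
qed

lemma coef_eqI: "u = \<Phi> x p \<Longrightarrow> coef p u = x"
  by (simp add: coef_frame)

lemma coef_add:
  "u \<in> tangent_space A p \<Longrightarrow> v \<in> tangent_space A p \<Longrightarrow> coef p (u + v) = coef p u + coef p v"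
  by (rule coef_eqI) (simp add: frame_add frame_coef)

lemma coef_tscale: "u \<in> tangent_space A p \<Longrightarrow> coef p (tscale c u) = c *\<^sub>R coef p u"
  by (rule coef_eqI) (simp add: frame_scale_at frame_coef)

lemma coef_translate: "u \<in> tangent_space A p \<Longrightarrow> coef (a + p) (dleft a u) = coef p u"
  by (rule coef_eqI) (simp add: frame_translate frame_coef)

text \<open>
  Translating to the identity reads off the coefficients of \<open>X q\<close> as the derivative along
  \<open>X q\<close> of coordinate functions translated by \<open>- q\<close>, which depend smoothly on \<open>q\<close>.
\<close>

lemma coef_smooth:
  assumes X: "X \<in> vector_fields A"
  shows "smooth_near A p (\<lambda>q. coef q (X q) \<bullet> b)"
proof -
  obtain U \<phi> where U: "(U, \<phi>) \<in> A" "0 \<in> U" by (rule chart_at)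
  have eq: "coef q (X q) \<bullet> b =
    (\<Sum>c\<in>Basis. (coef 0 (chart_vec A U \<phi> 0 c) \<bullet> b) * X q (\<lambda>r. \<phi> (- q + r) \<bullet> c))" for q
  proof -
    have X0: "dleft (- q) (X q) \<in> tangent_space A 0"
      using dleft_tangent[OF vector_field_tangent[OF X], of "- q" q] by simp
    have c: "chart_vec A U \<phi> 0 v \<in> tangent_space A 0" for v by (simp add: tangent_space_eq[OF U])
    from X0 obtain w where w: "dleft (- q) (X q) = chart_vec A U \<phi> 0 w"
      unfolding tangent_space_eq[OF U] by auto
    have lin: "linear (\<lambda>v. coef 0 (chart_vec A U \<phi> 0 v))"
      by (rule linearI) (simp_all add: chart_vec_linear[OF U] coef_add coef_tscale c)
    have "coef 0 (chart_vec A U \<phi> 0 (\<Sum>b\<in>Basis. (w \<bullet> b) *\<^sub>R b)) =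
        (\<Sum>b\<in>Basis. (w \<bullet> b) *\<^sub>R coef 0 (chart_vec A U \<phi> 0 b))"
      unfolding linear_sum[OF lin] linear_scale[OF lin] ..
    then have "coef 0 (chart_vec A U \<phi> 0 w) = (\<Sum>b\<in>Basis. (w \<bullet> b) *\<^sub>R coef 0 (chart_vec A U \<phi> 0 b))"
      by (simp only: euclidean_representation)
    moreover have "w \<bullet> c = X q (\<lambda>r. \<phi> (- q + r) \<bullet> c)" for c
      using chart_vec_coordinate[OF U, of w c] fun_cong[OF w, of "\<lambda>q. \<phi> q \<bullet> c"] by (simp add: dleft_def)
    moreover have "coef q (X q) = coef 0 (chart_vec A U \<phi> 0 w)"
      using coef_translate[OF vector_field_tangent[OF X], of "- q" q] by (simp add: w)
    ultimately have "coef q (X q) =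
        (\<Sum>c\<in>Basis. X q (\<lambda>r. \<phi> (- q + r) \<bullet> c) *\<^sub>R coef 0 (chart_vec A U \<phi> 0 c))"
      by simp
    then show ?thesis by (simp only: inner_sum_left inner_scaleR_left mult.commute)
  qed
  have "smooth_near2 A p p (\<lambda>a r. \<phi> (- a + r) \<bullet> c)" for c
    by (rule smooth_near2_uminus, rule smooth_near2_plus) (use smooth_near_coordinate[OF U] in simp)
  from smooth_near_vector_field_apply[OF X this]
  show ?thesis unfolding eq by (intro smooth_near_sum smooth_near_cmult)
qed

lemma frame_field_vector_field:
  assumes "\<And>p b. smooth_near A p (\<lambda>q. y q \<bullet> b)"
  shows "(\<lambda>p. \<Phi> (y p) p) \<in> vector_fields A"
  unfolding vector_fields_iff
  by (auto intro: frame_tangent) (subst frame_expand, intro smooth_near_sum smooth_near_mult assms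
      vector_field_smooth[OF frame_vector_field])

end

section \<open>Anti-Kaehler structures from their infinitesimal data\<close>

lemma bilinear_expand:
  fixes B :: "'v::euclidean_space \<Rightarrow> 'w::euclidean_space \<Rightarrow> 'z::real_vector"
  assumes "bilinear B"
  shows "B x y = (\<Sum>b\<in>Basis. \<Sum>c\<in>Basis. ((x \<bullet> b) * (y \<bullet> c)) *\<^sub>R B b c)"
proof -
  have "B x y = B (\<Sum>b\<in>Basis. (x \<bullet> b) *\<^sub>R b) (\<Sum>c\<in>Basis. (y \<bullet> c) *\<^sub>R c)"
    by (simp only: euclidean_representation)
  also have "\<dots> = (\<Sum>(b, c)\<in>Basis \<times> Basis. B ((x \<bullet> b) *\<^sub>R b) ((y \<bullet> c) *\<^sub>R c))"
    by (rule bilinear_sum[OF assms])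
  finally show ?thesis
    by (simp add: sum.cartesian_product bilinear_lmul[OF assms] bilinear_rmul[OF assms] mult.commute)
qed

lemma linear_expand:
  fixes l :: "'v::euclidean_space \<Rightarrow> 'z::real_vector"
  assumes "linear l"
  shows "l x = (\<Sum>b\<in>Basis. (x \<bullet> b) *\<^sub>R l b)"
proof -
  have "l x = l (\<Sum>b\<in>Basis. (x \<bullet> b) *\<^sub>R b)" by (simp only: euclidean_representation)
  then show ?thesis by (simp only: linear_sum[OF assms] linear_scale[OF assms])
qed

text \<open>Applied to frame coefficients, this is the flat connection for which the frame is
  parallel. The Levi-Civita connection will differ from it by a bilinear term with constant
  coefficients.\<close>

definition tderiv :: "'g tvec \<Rightarrow> ('g \<Rightarrow> 'v::euclidean_space) \<Rightarrow> 'v" where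
  "tderiv u y = (\<Sum>b\<in>Basis. u (\<lambda>q. y q \<bullet> b) *\<^sub>R b)"

section \<open>Componentwise calculus for vector valued functions\<close>

context smooth_mfd
begin

definition smooth_vec :: "'g \<Rightarrow> ('g \<Rightarrow> 'v::euclidean_space) \<Rightarrow> bool" where
  "smooth_vec p y \<longleftrightarrow> (\<forall>b. smooth_near A p (\<lambda>q. y q \<bullet> b))"

lemma smooth_near_linear:
  assumes "linear l" "smooth_vec p y"
  shows "smooth_near A p (\<lambda>q. l (y q) :: real)"
  using assms(2) unfolding linear_expand[OF assms(1), of "y _"] smooth_vec_def
  by (auto intro!: smooth_near_sum smooth_near_mult smooth_near_const)

lemma smooth_near_bilinear:
  assumes "bilinear B" "smooth_vec p y" "smooth_vec p z"
  shows "smooth_near A p (\<lambda>q. B (y q) (z q) :: real)"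
  using assms(2,3) unfolding bilinear_expand[OF assms(1), of "y _" "z _"] smooth_vec_def
  by (auto intro!: smooth_near_sum smooth_near_mult smooth_near_const)

lemma tangent_apply_linear:
  assumes u: "u \<in> tangent_space A p" and l: "linear l" and y: "smooth_vec p y"
  shows "u (\<lambda>q. l (y q)) = l (tderiv u y)"
proof -
  have "u (\<lambda>q. l (y q)) = u (\<lambda>q. \<Sum>b\<in>Basis. l b * (y q \<bullet> b))"
    by (simp add: linear_expand[OF l, of "y _"] mult.commute)
  also have "\<dots> = (\<Sum>b\<in>Basis. u (\<lambda>q. l b * (y q \<bullet> b)))"
    using y by (intro tangent_apply_sum[OF u] smooth_near_cmult) (simp add: smooth_vec_def)
  also have "\<dots> = (\<Sum>b\<in>Basis. l b * u (\<lambda>q. y q \<bullet> b))"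
    using y by (intro sum.cong refl tangent_apply_cmult[OF u]) (simp add: smooth_vec_def)
  finally show ?thesis
    by (simp add: tderiv_def linear_sum[OF l] linear_scale[OF l] mult.commute)
qed

lemma tderiv_inner:
  "u \<in> tangent_space A p \<Longrightarrow> smooth_vec p y \<Longrightarrow> tderiv u y \<bullet> b = u (\<lambda>q. y q \<bullet> b)"
  using tangent_apply_linear[of u p "\<lambda>x. x \<bullet> b" y] by (simp add: linear_iff inner_left_distrib)

lemma smooth_vec_linear: "linear l \<Longrightarrow> smooth_vec p y \<Longrightarrow> smooth_vec p (\<lambda>q. l (y q))"
  using smooth_near_linear[of "\<lambda>x. l x \<bullet> _"]
  by (auto simp: smooth_vec_def linear_iff inner_left_distrib)

lemma tderiv_linear:
  assumes "u \<in> tangent_space A p" "linear l" "smooth_vec p y"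
  shows "tderiv u (\<lambda>q. l (y q)) = l (tderiv u y)"
proof (rule euclidean_eqI)
  fix b
  have "linear (\<lambda>x. l x \<bullet> b)" using assms(2) by (simp add: linear_iff inner_left_distrib)
  then show "tderiv u (\<lambda>q. l (y q)) \<bullet> b = l (tderiv u y) \<bullet> b"
    using tangent_apply_linear[OF assms(1) _ assms(3)] tderiv_inner[OF assms(1) smooth_vec_linear[OF assms(2,3)]]
    by simp
qed

lemma tangent_apply_bilinear:
  assumes u: "u \<in> tangent_space A p" and B: "bilinear B" and y: "smooth_vec p y" and z: "smooth_vec p z"
  shows "u (\<lambda>q. B (y q) (z q)) = B (tderiv u y) (z p) + B (y p) (tderiv u z)"
proof -
  have s: "smooth_near A p (\<lambda>q. y q \<bullet> b)" "smooth_near A p (\<lambda>q. z q \<bullet> c)" for b c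
    using y z by (auto simp: smooth_vec_def)
  have "u (\<lambda>q. B (y q) (z q)) = u (\<lambda>q. \<Sum>b\<in>Basis. \<Sum>c\<in>Basis. B b c * ((y q \<bullet> b) * (z q \<bullet> c)))"
    by (simp add: bilinear_expand[OF B, of "y _"] mult.commute)
  also have "\<dots> = (\<Sum>b\<in>Basis. \<Sum>c\<in>Basis. u (\<lambda>q. B b c * ((y q \<bullet> b) * (z q \<bullet> c))))"
    by (simp add: tangent_apply_sum[OF u] smooth_near_sum smooth_near_cmult smooth_near_mult s)
  also have "\<dots> = (\<Sum>b\<in>Basis. \<Sum>c\<in>Basis. B b c *
      ((y p \<bullet> b) * (tderiv u z \<bullet> c) + (tderiv u y \<bullet> b) * (z p \<bullet> c)))"
    by (simp add: tangent_apply_cmult[OF u] smooth_near_mult s tangent_apply_mult[OF u] tderiv_inner[OF u y]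
        tderiv_inner[OF u z])
  finally show ?thesis
    by (simp add: bilinear_expand[OF B, of "tderiv u y"] bilinear_expand[OF B, of _ "tderiv u z"]
        sum.distrib algebra_simps)
qed

lemma tderiv_add:
  "u \<in> tangent_space A p \<Longrightarrow> smooth_vec p y \<Longrightarrow> smooth_vec p z \<Longrightarrow>
    tderiv u (\<lambda>q. y q + z q) = tderiv u y + tderiv u z"
  by (simp add: tderiv_def inner_left_distrib smooth_vec_def
      tangent_apply_add[of u p "\<lambda>q. y q \<bullet> b" "\<lambda>q. z q \<bullet> b" for b] scaleR_left_distrib sum.distrib)

lemma tderiv_scaleR:
  "u \<in> tangent_space A p \<Longrightarrow> smooth_near A p f \<Longrightarrow> smooth_vec p y \<Longrightarrow>
    tderiv u (\<lambda>q. f q *\<^sub>R y q) = f p *\<^sub>R tderiv u y + u f *\<^sub>R y p"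
  by (rule euclidean_eqI)
    (simp add: tderiv_def inner_sum_left inner_left_distrib inner_Basis smooth_vec_def
      tangent_apply_mult[of u p f "\<lambda>q. y q \<bullet> b" for b]
      if_distrib cong: if_cong)

lemma tderiv_plus: "tderiv (u + v) y = tderiv u y + tderiv v y"
  by (simp add: tderiv_def scaleR_left_distrib sum.distrib)

lemma tderiv_tscale: "tderiv (tscale c u) y = c *\<^sub>R tderiv u y"
  by (simp add: tderiv_def tscale_def scaleR_sum_right)

end

section \<open>Constructing the structure and its connection\<close>

context framed
begin

lemma frame_minus_at: "\<Phi> (- x) p = - \<Phi> x p"
  using frame_scale_at[of "-1" x p] by (simp add: tscale_def fun_eq_iff)

lemma frame_diff_at: "\<Phi> (x - y) p = \<Phi> x p - \<Phi> y p"
  using frame_add_at[of x "- y" p] by (simp add: frame_minus_at)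

lemma coef_smooth_vec: "X \<in> vector_fields A \<Longrightarrow> smooth_vec p (\<lambda>q. coef q (X q))"
  unfolding smooth_vec_def using coef_smooth by blast

text \<open>Separates the derivative of the coefficients of \<open>Y\<close>, a first order term,
  from the second order operators of the frame. In a commutator the latter reduce to brackets of
  frame fields.\<close>

lemma tangent_apply_field:
  assumes X: "X \<in> vector_fields A" and Y: "Y \<in> vector_fields A" and f: "smooth_near A p f"
  shows "X p (\<lambda>q. Y q f) = \<Phi> (tderiv (X p) (\<lambda>q. coef q (Y q))) p f +
    (\<Sum>b\<in>Basis. \<Sum>c\<in>Basis. ((coef p (Y p) \<bullet> b) * (coef p (X p) \<bullet> c)) * \<Phi> c p (\<lambda>q. \<Phi> b q f))"
proof -
  note u = vector_field_tangent[OF X, of p]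
  have Yq: "Y q f = (\<Sum>b\<in>Basis. (coef q (Y q) \<bullet> b) * \<Phi> b q f)" for q
    using frame_expand[of "coef q (Y q)" q f] frame_coef[OF vector_field_tangent[OF Y]] by simp
  have s: "smooth_near A p (\<lambda>q. coef q (Y q) \<bullet> b)" "smooth_near A p (\<lambda>q. \<Phi> b q f)" for b
    using coef_smooth[OF Y] vector_field_smooth[OF frame_vector_field f] by auto
  have "X p h = (\<Sum>c\<in>Basis. (coef p (X p) \<bullet> c) * \<Phi> c p h)" for h
    using frame_expand[of "coef p (X p)" p h] frame_coef[OF u] by simp
  note Xp = this[of "\<lambda>q. \<Phi> _ q f"]
  have "X p (\<lambda>q. Y q f) = (\<Sum>b\<in>Basis. X p (\<lambda>q. (coef q (Y q) \<bullet> b) * \<Phi> b q f))"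
    unfolding Yq by (intro tangent_apply_sum[OF u] smooth_near_mult s)
  also have "\<dots> = (\<Sum>b\<in>Basis. (coef p (Y p) \<bullet> b) * X p (\<lambda>q. \<Phi> b q f)) +
      (\<Sum>b\<in>Basis. X p (\<lambda>q. coef q (Y q) \<bullet> b) * \<Phi> b p f)"
    by (simp add: tangent_apply_mult[OF u] s sum.distrib)
  also have "(\<Sum>b\<in>Basis. X p (\<lambda>q. coef q (Y q) \<bullet> b) * \<Phi> b p f) = \<Phi> (tderiv (X p) (\<lambda>q. coef q (Y q))) p f"
    by (subst frame_expand) (simp add: tderiv_inner[OF u coef_smooth_vec[OF Y]])
  finally show ?thesis by (simp add: Xp sum_distrib_left mult.assoc)
qed

text \<open>With constant coefficients in the frame, \<open>g0\<close> and \<open>J0\<close> give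
  left invariant tensors, and the flat part \<open>tderiv\<close> is compatible with both. What
  remains of each condition on the connection is exactly one of the algebraic hypotheses on
  \<Gamma>.\<close>

lemma anti_kaehler_exists:
  fixes g0 :: "'v \<Rightarrow> 'v \<Rightarrow> real" and J0 :: "'v \<Rightarrow> 'v" and \<Gamma> :: "'v \<Rightarrow> 'v \<Rightarrow> 'v"
  assumes g: "bilinear g0" "\<And>x y. g0 x y = g0 y x" "\<And>x. \<forall>y. g0 x y = 0 \<Longrightarrow> x = 0"
    and J: "linear J0" "\<And>x. J0 (J0 x) = - x" "\<And>x y. g0 (J0 x) (J0 y) = - g0 x y"
    and G: "bilinear \<Gamma>" "\<And>x y. \<Gamma> x (J0 y) = J0 (\<Gamma> x y)" "\<And>x y z. g0 (\<Gamma> x y) z + g0 y (\<Gamma> x z) = 0"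
    and br: "\<And>x y. lie_bracket A (\<Phi> x) (\<Phi> y) = \<Phi> (\<Gamma> x y - \<Gamma> y x)"
  shows "\<exists>g J. left_invariant_anti_kaehler A g J"
proof -
  define gg where "gg = (\<lambda>p u v. g0 (coef p u) (coef p v))"
  define JJ where "JJ = (\<lambda>p u. \<Phi> (J0 (coef p u)) p)"
  define DD where "DD = (\<lambda>X Y p. \<Phi> (tderiv (X p) (\<lambda>q. coef q (Y q)) + \<Gamma> (coef p (X p)) (coef p (Y p))) p)"
  note tan = vector_field_tangent
  note gl = bilinear_ladd[OF g(1)] bilinear_lmul[OF g(1)] bilinear_radd[OF g(1)] bilinear_rmul[OF g(1)]
  note Gl = bilinear_ladd[OF G(1)] bilinear_lmul[OF G(1)] bilinear_radd[OF G(1)] bilinear_rmul[OF G(1)]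
  note Jl = linear_add[OF J(1)] linear_scale[OF J(1)]
  have coefD: "coef p (DD X Y p) = tderiv (X p) (\<lambda>q. coef q (Y q)) + \<Gamma> (coef p (X p)) (coef p (Y p))" for X Y p
    by (simp add: DD_def coef_frame)
  have coefJ: "coef p (JJ p u) = J0 (coef p u)" for p u by (simp add: JJ_def coef_frame)
  have metric: "pseudo_riemannian_metric A gg"
    unfolding pseudo_riemannian_metric_def
  proof (intro conjI allI ballI impI)
    fix p u v w c assume u: "u \<in> tangent_space A p" "v \<in> tangent_space A p" "w \<in> tangent_space A p"
    show "gg p (u + v) w = gg p u w + gg p v w" using u by (simp add: gg_def coef_add gl)
  next
    fix p u assume u: "u \<in> tangent_space A p" "\<forall>v\<in>tangent_space A p. gg p u v = 0"
    have "g0 (coef p u) y = 0" for y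
      using u(2) frame_tangent[of y p] by (auto simp: gg_def coef_frame dest!: bspec)
    then have "coef p u = 0" using g(3) by blast
    then show "u = 0"
      using frame_coef[OF u(1)] frame_scale_at[of 0 0 p] by (auto simp: tscale_def fun_eq_iff)
  next
    fix X Y assume "X \<in> vector_fields A" "Y \<in> vector_fields A"
    then show "smooth_fun_on A UNIV (\<lambda>p. gg p (X p) (Y p))"
      unfolding smooth_fun_on_iff[OF open_UNIV] gg_def
      by (intro ballI smooth_near_bilinear[OF g(1)] coef_smooth_vec)
  qed (use g(2) in \<open>auto simp: gg_def coef_tscale gl\<close>)
  have complex: "almost_complex_structure A JJ"
    unfolding almost_complex_structure_def
  proof (intro conjI allI ballI)
    fix X assume X: "X \<in> vector_fields A"
    show "(\<lambda>p. JJ p (X p)) \<in> vector_fields A"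
      unfolding JJ_def by (rule frame_field_vector_field)
        (use smooth_vec_linear[OF J(1) coef_smooth_vec[OF X]] in \<open>simp add: smooth_vec_def\<close>)
  qed (auto simp: JJ_def coef_add coef_tscale Jl frame_add_at frame_scale_at frame_tangent coef_frame J(2)
      frame_minus_at frame_coef)
  have DDv: "DD X Y \<in> vector_fields A" if "X \<in> vector_fields A" "Y \<in> vector_fields A" for X Y
    unfolding DD_def
  proof (rule frame_field_vector_field)
    fix p b
    have "bilinear (\<lambda>x y. \<Gamma> x y \<bullet> b)"
      by (auto simp: bilinear_def linear_iff Gl inner_left_distrib)
    from smooth_near_bilinear[OF this coef_smooth_vec[OF that(1)] coef_smooth_vec[OF that(2)]]
      vector_field_smooth[OF that(1) coef_smooth[OF that(2)]]
    show "smooth_near A p (\<lambda>q. (tderiv (X q) (\<lambda>q. coef q (Y q)) + \<Gamma> (coef q (X q)) (coef q (Y q))) \<bullet> b)"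
      by (simp add: inner_left_distrib tderiv_inner[OF tan[OF that(1)] coef_smooth_vec[OF that(2)]]
          smooth_near_add)
  qed
  have conn: "affine_connection A DD"
    unfolding affine_connection_def
  proof (intro conjI ballI allI impI)
    fix X Y assume "X \<in> vector_fields A" "Y \<in> vector_fields A"
    then show "DD X Y \<in> vector_fields A" by (rule DDv)
  next
    fix X Y Z assume v: "X \<in> vector_fields A" "Y \<in> vector_fields A" "Z \<in> vector_fields A"
    show "DD (X + Y) Z = DD X Z + DD Y Z"
      by (rule ext)
        (simp only: DD_def plus_fun_apply tderiv_plus coef_add[OF tan[OF v(1)] tan[OF v(2)]] Gl
          frame_add_at[symmetric] ac_simps)
    show "DD X (Y + Z) = DD X Y + DD X Z"
      by (rule ext)
        (simp only: DD_def plus_fun_apply coef_add[OF tan[OF v(2)] tan[OF v(3)]] Gl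
          tderiv_add[OF tan[OF v(1)] coef_smooth_vec[OF v(2)] coef_smooth_vec[OF v(3)]]
          frame_add_at[symmetric] ac_simps)
  next
    fix X Y f assume v: "X \<in> vector_fields A" "Y \<in> vector_fields A" and f: "smooth_fun_on A UNIV f"
    show "DD (fscale f X) Y = fscale f (DD X Y)"
      by (rule ext)
        (simp only: DD_def fscale_def tderiv_tscale coef_tscale[OF tan[OF v(1)]] Gl
          frame_scale_at[symmetric] scaleR_add_right)
    have f: "smooth_near A p f" for p using f smooth_fun_on_iff[OF open_UNIV] by auto
    show "DD X (fscale f Y) = fscale (\<lambda>p. X p f) Y + fscale f (DD X Y)"
    proof
      fix p
      have "DD X (fscale f Y) p = \<Phi> (X p f *\<^sub>R coef p (Y p)) p + \<Phi> (f p *\<^sub>R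
          (tderiv (X p) (\<lambda>q. coef q (Y q)) + \<Gamma> (coef p (X p)) (coef p (Y p)))) p"
        by (simp only: DD_def fscale_def coef_tscale[OF tan[OF v(2)]] Gl scaleR_add_right
          tderiv_scaleR[OF tan[OF v(1)] f coef_smooth_vec[OF v(2)]] frame_add_at[symmetric] ac_simps)
      then show "DD X (fscale f Y) p = (fscale (\<lambda>p. X p f) Y + fscale f (DD X Y)) p"
        by (simp only: frame_scale_at frame_coef[OF tan[OF v(2)]] plus_fun_apply fscale_def DD_def)
    qed
  qed
  have torsion: "DD X Y - DD Y X = lie_bracket A X Y" if v: "X \<in> vector_fields A" "Y \<in> vector_fields A" for X Y
  proof (rule ext, rule ext)
    fix p f
    show "(DD X Y - DD Y X) p f = lie_bracket A X Y p f"
    proof (cases "smooth_near A p f")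
      case False
      then show ?thesis
        using tangent_not_smooth[OF tan[OF DDv[OF v]]] tangent_not_smooth[OF tan[OF DDv[OF v(2,1)]]]
        by (simp add: lie_bracket_def)
    next
      case True
      define x where "x = coef p (X p)"
      define y where "y = coef p (Y p)"
      \<comment> \<open>\<open>E\<close> is not a tangent vector in either index, but its
        antisymmetric part is a frame bracket, known from \<open>br\<close>. Exchanging the two
        summations produces this antisymmetrisation from the difference of the second order
        sums.\<close>
      define E where "E = (\<lambda>b c. \<Phi> c p (\<lambda>q. \<Phi> b q f))"
      have E: "E b c - E c b = \<Phi> (\<Gamma> c b - \<Gamma> b c) p f" for b c
        using fun_cong[OF fun_cong[OF br[of c b], of p], of f] True by (simp add: lie_bracket_def E_def)
      have "bilinear (\<lambda>y x. \<Phi> (\<Gamma> x y - \<Gamma> y x) p f)"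
        by (auto simp: bilinear_def linear_iff Gl frame_diff_at frame_add_at frame_scale_at tscale_def algebra_simps)
      from bilinear_expand[OF this, where x=y and y=x]
      have "\<Phi> (\<Gamma> x y - \<Gamma> y x) p f = (\<Sum>b\<in>Basis. \<Sum>c\<in>Basis. (y \<bullet> b) * (x \<bullet> c) * (E b c - E c b))"
        by (simp only: E real_scaleR_def)
      also have "\<dots> = (\<Sum>b\<in>Basis. \<Sum>c\<in>Basis. (y \<bullet> b) * (x \<bullet> c) * E b c) -
          (\<Sum>b\<in>Basis. \<Sum>c\<in>Basis. (y \<bullet> b) * (x \<bullet> c) * E c b)"
        by (simp add: right_diff_distrib sum_subtractf)
      also have "(\<Sum>b\<in>Basis. \<Sum>c\<in>Basis. (y \<bullet> b) * (x \<bullet> c) * E c b) =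
          (\<Sum>b\<in>Basis. \<Sum>c\<in>Basis. (x \<bullet> b) * (y \<bullet> c) * E b c)"
        by (subst sum.swap) (simp add: mult.commute)
      finally show ?thesis
        using tangent_apply_field[OF v True] tangent_apply_field[OF v(2,1) True] True
        by (simp add: DD_def lie_bracket_def frame_add_at frame_diff_at E_def x_def y_def)
    qed
  qed
  \<comment> \<open>The product rule for \<open>g0\<close> accounts for the \<open>tderiv\<close>
    terms, and the two \<Gamma> terms cancel by skewness.\<close>
  have compat: "X p (\<lambda>q. gg q (Y q) (Z q)) = gg p (DD X Y p) (Z p) + gg p (Y p) (DD X Z p)"
    if v: "X \<in> vector_fields A" "Y \<in> vector_fields A" "Z \<in> vector_fields A" for X Y Z p
    using tangent_apply_bilinear[OF tan[OF v(1)] g(1) coef_smooth_vec[OF v(2)] coef_smooth_vec[OF v(3)]]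
      G(3)[of "coef p (X p)" "coef p (Y p)" "coef p (Z p)"]
    by (simp add: gg_def coefD gl)
  have par: "DD X (\<lambda>p. JJ p (Y p)) = (\<lambda>p. JJ p (DD X Y p))"
    if v: "X \<in> vector_fields A" "Y \<in> vector_fields A" for X Y
    by (rule ext) (simp add: DD_def JJ_def coef_frame G(2) Jl
        tderiv_linear[OF tan[OF v(1)] J(1) coef_smooth_vec[OF v(2)]])
  have "anti_kaehler A gg JJ"
    unfolding anti_kaehler_def levi_civita_connection_def
    using metric complex conn torsion compat par by (auto simp: gg_def coefJ J(3))
  then have "left_invariant_anti_kaehler A gg JJ"
    unfolding left_invariant_anti_kaehler_def
    by (auto simp: gg_def JJ_def coef_translate frame_translate)
  then show ?thesis by blast
qed

end

section \<open>The infinitesimal data of a left invariant anti-Kaehler structure\<close>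

context lie_grp
begin

text \<open>Translation commutes with both applications of the fields. Where this is applied, the
  bracket is a smooth field because it equals \<open>D X Y - D Y X\<close>.\<close>

lemma lie_bracket_left_invariant:
  assumes X: "X \<in> lie_algebra A" and Y: "Y \<in> lie_algebra A" and "lie_bracket A X Y \<in> vector_fields A"
  shows "lie_bracket A X Y \<in> lie_algebra A"
proof -
  have "lie_bracket A X Y (a + p) f = dleft a (lie_bracket A X Y p) f" for a p f
    by (simp add: lie_bracket_def dleft_def lie_algebra_translate[OF X] lie_algebra_translate[OF Y]
        smooth_near_translate[of a p f])
  then show ?thesis using assms(3) unfolding lie_algebra_def by (auto simp: fun_eq_iff)
qed

lemma vector_fields_diff:
  assumes "X \<in> vector_fields A" "Y \<in> vector_fields A"
  shows "X - Y \<in> vector_fields A"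
proof -
  have "(X - Y) p \<in> tangent_space A p" for p
  proof -
    have "(X - Y) p = X p + tscale (-1) (Y p)" by (auto simp: tscale_def)
    then show ?thesis using assms by (metis tangent_add tangent_tscale vector_field_tangent)
  qed
  moreover have "smooth_near A p (\<lambda>q. (X - Y) q f)" if "smooth_near A p f" for p f
    using smooth_near_diff[OF vector_field_smooth[OF assms(1) that] vector_field_smooth[OF assms(2) that]]
    by simp
  ultimately show ?thesis unfolding vector_fields_iff by blast
qed

text \<open>The inner bracket is a commutator only where \<open>f\<close> is smooth, so locality of
  \<open>X p\<close> is used on a neighbourhood of such points. In the cyclic sum of this formula
  all terms cancel in pairs.\<close>

lemma lie_bracket_nested:
  assumes X: "X \<in> vector_fields A" and Y: "Y \<in> vector_fields A" and Z: "Z \<in> vector_fields A"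
    and f: "smooth_near A p f"
  shows "lie_bracket A X (lie_bracket A Y Z) p f =
    X p (\<lambda>q. Y q (\<lambda>r. Z r f)) - X p (\<lambda>q. Z q (\<lambda>r. Y r f)) -
    Y p (\<lambda>q. Z q (\<lambda>r. X r f)) + Z p (\<lambda>q. Y q (\<lambda>r. X r f))"
proof -
  obtain S where S: "open S" "p \<in> S" "\<And>q. q \<in> S \<Longrightarrow> smooth_near A q f"
    using smooth_near_nbhd[OF f] by auto
  note sX = vector_field_smooth[OF X] and sY = vector_field_smooth[OF Y] and sZ = vector_field_smooth[OF Z]
  have "X p (\<lambda>q. lie_bracket A Y Z q f) = X p (\<lambda>q. Y q (\<lambda>r. Z r f) - Z q (\<lambda>r. Y r f))"
    by (rule tangent_apply_cong[OF vector_field_tangent[OF X] S(1,2)]) (simp add: lie_bracket_def S(3))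
  also have "\<dots> = X p (\<lambda>q. Y q (\<lambda>r. Z r f)) - X p (\<lambda>q. Z q (\<lambda>r. Y r f))"
    by (rule tangent_apply_diff[OF vector_field_tangent[OF X] sY[OF sZ[OF f]] sZ[OF sY[OF f]]])
  finally show ?thesis using f sX[OF f] by (simp add: lie_bracket_def)
qed

lemma lie_bracket_jacobi:
  assumes X: "X \<in> vector_fields A" and Y: "Y \<in> vector_fields A" and Z: "Z \<in> vector_fields A"
  shows "lie_bracket A X (lie_bracket A Y Z) + lie_bracket A Y (lie_bracket A Z X) +
    lie_bracket A Z (lie_bracket A X Y) = 0"
proof (rule ext, rule ext)
  fix p f
  show "(lie_bracket A X (lie_bracket A Y Z) + lie_bracket A Y (lie_bracket A Z X) +
    lie_bracket A Z (lie_bracket A X Y)) p f = 0 p f"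
  proof (cases "smooth_near A p f")
    case True
    show ?thesis
      using lie_bracket_nested[OF X Y Z True] lie_bracket_nested[OF Y Z X True]
        lie_bracket_nested[OF Z X Y True] by simp
  qed (simp add: lie_bracket_def)
qed

end

context framed
begin

text \<open>All data are read off at the identity, where the defining equations are evaluated on
  frame fields. Only the bracket has to be recovered as a whole field, and left invariance does
  that.\<close>

lemma anti_kaehler_data:
  assumes "left_invariant_anti_kaehler A g J"
  obtains g0 :: "'v \<Rightarrow> 'v \<Rightarrow> real" and J0 :: "'v \<Rightarrow> 'v" and \<Gamma> :: "'v \<Rightarrow> 'v \<Rightarrow> 'v"
  where "bilinear g0" "\<And>x y. g0 x y = g0 y x" "\<And>x. \<forall>y. g0 x y = 0 \<Longrightarrow> x = 0"
    "linear J0" "\<And>x. J0 (J0 x) = - x" "\<And>x y. g0 (J0 x) (J0 y) = - g0 x y"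
    "bilinear \<Gamma>" "\<And>x y. \<Gamma> x (J0 y) = J0 (\<Gamma> x y)" "\<And>x y z. g0 (\<Gamma> x y) z + g0 y (\<Gamma> x z) = 0"
    "\<And>x y. lie_bracket A (\<Phi> x) (\<Phi> y) = \<Phi> (\<Gamma> x y - \<Gamma> y x)"
proof -
  have ak: "anti_kaehler A g J" and gi: "\<And>a p u v. u \<in> tangent_space A p \<Longrightarrow> v \<in> tangent_space A p \<Longrightarrow>
        g (a + p) (dleft a u) (dleft a v) = g p u v"
    and Ji: "\<And>a p u. u \<in> tangent_space A p \<Longrightarrow> J (a + p) (dleft a u) = dleft a (J p u)"
    using assms unfolding left_invariant_anti_kaehler_def by blast+
  have pr: "pseudo_riemannian_metric A g" and ac: "almost_complex_structure A J"
    and gJ: "\<And>p u v. u \<in> tangent_space A p \<Longrightarrow> v \<in> tangent_space A p \<Longrightarrow> g p (J p u) (J p v) = - g p u v"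
    using ak unfolding anti_kaehler_def by blast+
  obtain D where D: "levi_civita_connection A g D"
    and DJ: "\<And>X Y. X \<in> vector_fields A \<Longrightarrow> Y \<in> vector_fields A \<Longrightarrow>
           D X (\<lambda>p. J p (Y p)) = (\<lambda>p. J p (D X Y p))"
    using ak unfolding anti_kaehler_def by blast
  have conn: "affine_connection A D"
    and tors: "\<And>X Y. X \<in> vector_fields A \<Longrightarrow> Y \<in> vector_fields A \<Longrightarrow> D X Y - D Y X = lie_bracket A X Y"
    and compat: "\<And>X Y Z p. X \<in> vector_fields A \<Longrightarrow> Y \<in> vector_fields A \<Longrightarrow> Z \<in> vector_fields A \<Longrightarrow>
        X p (\<lambda>q. g q (Y q) (Z q)) = g p (D X Y p) (Z p) + g p (Y p) (D X Z p)"
    using D unfolding levi_civita_connection_def by blast+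
  have gsym: "g p u v = g p v u" and gadd: "g p (u + v) w = g p u w + g p v w"
    and gscale: "g p (tscale c u) v = c * g p u v"
    if "u \<in> tangent_space A p" "v \<in> tangent_space A p" "w \<in> tangent_space A p" for p u v w c
    using pr that unfolding pseudo_riemannian_metric_def by blast+
  have gnd: "u = 0" if "u \<in> tangent_space A p" "\<forall>v\<in>tangent_space A p. g p u v = 0" for p u
    using pr that unfolding pseudo_riemannian_metric_def by blast
  have Jt: "J p u \<in> tangent_space A p" and Jadd: "J p (u + v) = J p u + J p v"
    and Jscale: "J p (tscale c u) = tscale c (J p u)" and JJ: "J p (J p u) = - u"
    if "u \<in> tangent_space A p" "v \<in> tangent_space A p" for p u v c
    using ac that unfolding almost_complex_structure_def by blast+
  have Dv: "D X Y \<in> vector_fields A" if "X \<in> vector_fields A" "Y \<in> vector_fields A" for X Y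
    using conn that unfolding affine_connection_def by blast
  have Dadd: "D (X + Y) Z = D X Z + D Y Z" "D X (Y + Z) = D X Y + D X Z"
    if "X \<in> vector_fields A" "Y \<in> vector_fields A" "Z \<in> vector_fields A" for X Y Z
    using conn that unfolding affine_connection_def by blast+
  have Dscale: "D (fscale u X) Y = fscale u (D X Y)"
    "D X (fscale u Y) = fscale (\<lambda>p. X p u) Y + fscale u (D X Y)"
    if "X \<in> vector_fields A" "Y \<in> vector_fields A" "smooth_fun_on A UNIV u" for X Y u
    using conn that unfolding affine_connection_def by blast+
  have const: "smooth_fun_on A UNIV (\<lambda>_. c)" for c
    by (simp add: smooth_fun_on_iff smooth_near_const)
  note vf = frame_vector_field and ft = frame_tangent
  define g0 where "g0 = (\<lambda>x y. g 0 (\<Phi> x 0) (\<Phi> y 0))"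
  define J0 where "J0 = (\<lambda>x. coef 0 (J 0 (\<Phi> x 0)))"
  define \<Gamma> where "\<Gamma> = (\<lambda>x y. coef 0 (D (\<Phi> x) (\<Phi> y) 0))"
  \<comment> \<open>Left invariance spreads the values at the identity: \<open>J\<close> sends frame
    fields to frame fields, and \<open>g\<close> of two frame fields is a constant function.\<close>
  have \<Phi>J: "J p (\<Phi> x p) = \<Phi> (J0 x) p" for p x
    using Ji[OF ft[of x 0], of p] frame_translate[of x p 0] frame_translate[of "J0 x" p 0]
    by (simp add: J0_def frame_coef[OF Jt[OF ft ft]])
  have \<Phi>g: "g p (\<Phi> x p) (\<Phi> y p) = g0 x y" for p x y
    using gi[OF ft[of x 0] ft[of y 0], of p] frame_translate[of x p 0] frame_translate[of y p 0]
    by (simp add: g0_def)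
  have \<Phi>\<Gamma>: "D (\<Phi> x) (\<Phi> y) 0 = \<Phi> (\<Gamma> x y) 0" for x y
    by (simp add: \<Gamma>_def frame_coef[OF vector_field_tangent[OF Dv[OF vf vf]]])
  show thesis
  proof (rule that[of g0 J0 \<Gamma>])
    show sym: "g0 x y = g0 y x" for x y unfolding g0_def by (rule gsym[OF ft ft ft])
    have lin: "linear (\<lambda>x. g0 x y)" for y
      by (rule linearI) (simp_all add: g0_def frame_add_at frame_scale_at gadd[OF ft ft ft] gscale[OF ft ft ft])
    have "g0 x = (\<lambda>y. g0 y x)" for x by (rule ext) (rule sym)
    with lin show "bilinear g0" unfolding bilinear_def by metis
    show "x = 0" if "\<forall>y. g0 x y = 0" for x
    proof -
      have "\<Phi> x 0 = 0"
        by (rule gnd[OF ft]) (metis that g0_def frame_coef)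
      then have "\<Phi> x 0 = \<Phi> 0 0" using frame_scale_at[of 0 0 0] by (simp add: tscale_def fun_eq_iff)
      then show ?thesis by (rule frame_at_inj)
    qed
    show "linear J0"
      by (rule linearI) (simp_all add: J0_def frame_add_at frame_scale_at Jadd[OF ft ft] Jscale[OF ft ft]
          coef_add[OF Jt[OF ft ft] Jt[OF ft ft]] coef_tscale[OF Jt[OF ft ft]])
    have "\<Phi> (J0 (J0 x)) 0 = \<Phi> (- x) 0" for x
      using JJ[OF ft[of x 0] ft[of x 0]] frame_scale_at[of "-1" x 0] by (simp add: \<Phi>J tscale_def fun_eq_iff)
    then show "J0 (J0 x) = - x" for x by (rule frame_at_inj)
    show "g0 (J0 x) (J0 y) = - g0 x y" for x y
      using gJ[OF ft[of x 0] ft[of y 0]] by (simp add: \<Phi>J \<Phi>g)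
    have "linear (\<lambda>x. \<Gamma> x y)" for y
      by (rule linearI) (simp_all add: \<Gamma>_def frame_add frame_scale Dadd(1)[OF vf vf vf] fscale_def
          Dscale(1)[OF vf vf const, unfolded fscale_def]
          coef_add[OF vector_field_tangent[OF Dv[OF vf vf]] vector_field_tangent[OF Dv[OF vf vf]]]
          coef_tscale[OF vector_field_tangent[OF Dv[OF vf vf]]])
    moreover have "linear (\<Gamma> x)" for x
    proof (rule linearI)
      show "\<Gamma> x (y + z) = \<Gamma> x y + \<Gamma> x z" for y z
        by (simp add: \<Gamma>_def frame_add Dadd(2)[OF vf vf vf]
          coef_add[OF vector_field_tangent[OF Dv[OF vf vf]] vector_field_tangent[OF Dv[OF vf vf]]])
      show "\<Gamma> x (c *\<^sub>R y) = c *\<^sub>R \<Gamma> x y" for c y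
      proof -
        \<comment> \<open>The Leibniz term differentiates the constant function \<open>c\<close> and
          vanishes.\<close>
        have "D (\<Phi> x) (\<Phi> (c *\<^sub>R y)) 0 = tscale c (D (\<Phi> x) (\<Phi> y) 0)"
          by (simp add: frame_scale Dscale(2)[OF vf vf const])
            (simp add: fscale_def tscale_def tangent_apply_const[OF ft] fun_eq_iff)
        then show ?thesis by (simp add: \<Gamma>_def coef_tscale[OF vector_field_tangent[OF Dv[OF vf vf]]])
      qed
    qed
    ultimately show "bilinear \<Gamma>" unfolding bilinear_def by blast
    show "\<Gamma> x (J0 y) = J0 (\<Gamma> x y)" for x y
    proof -
      have "D (\<Phi> x) (\<Phi> (J0 y)) 0 = J 0 (D (\<Phi> x) (\<Phi> y) 0)"
        using fun_cong[OF DJ[OF vf[of x] vf[of y]], of 0] by (simp add: \<Phi>J)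
      then show ?thesis by (simp add: \<Phi>\<Gamma> \<Phi>J frame_at_inj)
    qed
    \<comment> \<open>The left side of metric compatibility differentiates the constant
      \<open>g0 y z\<close>.\<close>
    show "g0 (\<Gamma> x y) z + g0 y (\<Gamma> x z) = 0" for x y z
      using compat[OF vf[of x] vf[of y] vf[of z], of 0]
      by (simp add: \<Phi>g \<Phi>\<Gamma> tangent_apply_const[OF ft])
    show "lie_bracket A (\<Phi> x) (\<Phi> y) = \<Phi> (\<Gamma> x y - \<Gamma> y x)" for x y
    proof -
      have "lie_bracket A (\<Phi> x) (\<Phi> y) \<in> vector_fields A"
        using vector_fields_diff[OF Dv[OF vf[of x] vf[of y]] Dv[OF vf[of y] vf[of x]]] tors[OF vf[of x] vf[of y]] by simp
      then have "lie_bracket A (\<Phi> x) (\<Phi> y) \<in> lie_algebra A"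
        by (rule lie_bracket_left_invariant[OF frame_lie_algebra frame_lie_algebra])
      then obtain w where w: "lie_bracket A (\<Phi> x) (\<Phi> y) = \<Phi> w"
        using frame_bij by (auto simp: bij_betw_def)
      \<comment> \<open>The bracket is a frame field, so the torsion equation at the identity
        determines its coefficient vector \<open>w\<close>.\<close>
      have "\<Phi> w 0 + \<Phi> (\<Gamma> y x) 0 = \<Phi> (\<Gamma> x y) 0"
        using fun_cong[OF tors[OF vf[of x] vf[of y]], of 0] by (auto simp: w \<Phi>\<Gamma> algebra_simps)
      then have "w + \<Gamma> y x = \<Gamma> x y" unfolding frame_add_at[symmetric] by (rule frame_at_inj)
      then have "w = \<Gamma> x y - \<Gamma> y x" by (simp add: algebra_simps)
      then show ?thesis using w by simp
    qed
  qed
qed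

lemma frame_jacobi:
  assumes "\<And>x y. lie_bracket A (\<Phi> x) (\<Phi> y) = \<Phi> (br x y)"
  shows "br x (br y z) + br y (br z x) + br z (br x y) = 0"
proof -
  have "\<Phi> (br x (br y z) + br y (br z x) + br z (br x y)) 0 = \<Phi> 0 0"
    using fun_cong[OF lie_bracket_jacobi[OF frame_vector_field[of x] frame_vector_field[of y]
          frame_vector_field[of z]], of 0]
      frame_scale_at[of 0 0 0]
    by (simp add: assms frame_add_at tscale_def fun_eq_iff)
  then show ?thesis by (rule frame_at_inj)
qed

end

section \<open>Classification of the infinitesimal data\<close>

lemma bracket_r_nth:
  "bracket_r x y $ 1 = 0"
  "bracket_r x y $ 2 = x $ 1 * y $ 2 - x $ 2 * y $ 1"
  "bracket_r x y $ 3 = - (x $ 1 * y $ 3 - x $ 3 * y $ 1)"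
  "bracket_r x y $ 4 = - (x $ 1 * y $ 4 - x $ 4 * y $ 1)"
  by (simp_all add: bracket_r_def table_bracket_def sum_4 axis_def)

lemma bracket_aff_nth:
  "bracket_aff x y $ 1 = 0"
  "bracket_aff x y $ 2 = 0"
  "bracket_aff x y $ 3 = (x $ 1 * y $ 3 - x $ 3 * y $ 1) - (x $ 2 * y $ 4 - x $ 4 * y $ 2)"
  "bracket_aff x y $ 4 = (x $ 1 * y $ 4 - x $ 4 * y $ 1) + (x $ 2 * y $ 3 - x $ 3 * y $ 2)"
  by (simp_all add: bracket_aff_def table_bracket_def sum_4 axis_def)

lemma linear_inj_imp_bij:
  fixes f :: "'a::euclidean_space \<Rightarrow> 'b::euclidean_space"
  assumes "linear f" "\<And>x. f x = 0 \<Longrightarrow> x = 0" "DIM('a) = DIM('b)"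
  shows "bij f"
proof -
  have "inj f" using assms(1,2) by (simp add: linear_injective_0)
  with assms show ?thesis by (simp add: bij_def eucl.linear_injective_imp_surjective)
qed

text \<open>
  In complex coordinates with respect to a null basis, the form is \<open>Re (z\<^sub>1 w\<^sub>2 + z\<^sub>2 w\<^sub>1)\<close> and the
  complex linear skew maps are the multiples of \<open>diag(1, -1)\<close>, so that the connection is given by
  a single real linear function \<open>\<rho>\<close>; \<open>null_bracket \<rho>\<close> is the corresponding torsion free bracket.
\<close>

definition null_form :: "complex \<times> complex \<Rightarrow> complex \<times> complex \<Rightarrow> real" where
  "null_form z w = Re (fst z * snd w + snd z * fst w)"

definition null_bracket ::
  "(complex \<times> complex \<Rightarrow> complex) \<Rightarrow> complex \<times> complex \<Rightarrow> complex \<times> complex \<Rightarrow> complex \<times> complex" where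
  "null_bracket \<rho> z w = (\<rho> z * fst w - \<rho> w * fst z, \<rho> w * snd z - \<rho> z * snd w)"

text \<open>Normalise a non-null vector \<open>u\<close>, then one in its orthogonal complement, for
  the complex form \<open>h\<close>; the combinations \<open>u + \<i> w\<close> and
  \<open>(u - \<i> w) / 2\<close> are null and pair to 1.\<close>

lemma null_basis_exists:
  fixes g :: "'v::euclidean_space \<Rightarrow> 'v \<Rightarrow> real" and J :: "'v \<Rightarrow> 'v"
  assumes dim: "DIM('v) = 4"
    and g: "bilinear g" "\<And>x y. g x y = g y x" "\<And>x. \<forall>y. g x y = 0 \<Longrightarrow> x = 0"
    and J: "linear J" "\<And>x. J (J x) = - x" "\<And>x y. g (J x) (J y) = - g x y"
  obtains T where "linear T" "bij T" "\<And>z. T (\<i> * fst z, \<i> * snd z) = J (T z)"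
    "\<And>z w. g (T z) (T w) = null_form z w"
proof -
  note gl = bilinear_ladd[OF g(1)] bilinear_lmul[OF g(1)] bilinear_radd[OF g(1)] bilinear_rmul[OF g(1)]
    bilinear_lneg[OF g(1)] bilinear_rneg[OF g(1)] bilinear_lsub[OF g(1)] bilinear_rsub[OF g(1)]
  note Jl = linear_add[OF J(1)] linear_scale[OF J(1)] J(2)
  have gJ: "g x (J y) = g (J x) y" for x y
    using J(3)[of "J x" y] by (simp add: J(2) gl)
  define h where "h = (\<lambda>x y. Complex (g x y) (- g (J x) y))"
  \<comment> \<open>Complex scalar multiplication on the real space \<open>'v\<close>, with
    \<open>J\<close> acting as \<i>.\<close>
  define cs where "cs = (\<lambda>c x. Re c *\<^sub>R x + Im c *\<^sub>R J x)"
  have h_sym: "h x y = h y x" for x y using gJ g(2) by (metis h_def)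
  have h_add: "h (x + y) z = h x z + h y z" "h x (y + z) = h x y + h x z" for x y z
    by (simp_all add: h_def gl Jl complex_eq_iff)
  have h_cs: "h (cs c x) y = c * h x y" for c x y
    by (simp add: h_def cs_def gl Jl complex_eq_iff)
  have h_cs': "h x (cs c y) = c * h x y" for c x y
    using h_cs h_sym by metis
  have cs_J: "cs (\<i> * c) x = J (cs c x)" for c x by (simp add: cs_def Jl)
  have h_nd: "x = 0" if "\<And>y. h x y = 0" for x
  proof (rule g(3), rule allI)
    fix y
    show "g x y = 0" using arg_cong[OF that[of y], of Re] by (simp add: h_def)
  qed
  \<comment> \<open>Polarisation: a symmetric form that vanishes on these three vectors also
    vanishes on the pair.\<close>
  have polar: "\<exists>z\<in>{x, y, x + y}. h z z \<noteq> 0" if "h x y \<noteq> 0" for x y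
  proof (rule ccontr)
    assume "\<not> ?thesis"
    then show False using that h_sym[of y x] by (auto simp: h_add)
  qed
  have unit: "\<exists>c. h (cs c x) (cs c x) = 1" if "h x x \<noteq> 0" for x
  proof
    show "h (cs (1 / csqrt (h x x)) x) (cs (1 / csqrt (h x x)) x) = 1"
      using that power2_csqrt[of "h x x"] by (simp add: h_cs h_cs' power2_eq_square)
  qed
  obtain b :: 'v where "b \<noteq> 0" using nonzero_Basis nonempty_Basis by blast
  then obtain y where "h b y \<noteq> 0" using h_nd by blast
  from polar[OF this] obtain u where u: "h u u = 1" using unit by metis
  \<comment> \<open>This span is the complex line of \<open>u\<close>; a vector outside it has
    nonzero orthogonal part \<open>pr v\<close>.\<close>
  have "span {u, J u} \<noteq> UNIV"
  proof
    assume "span {u, J u} = UNIV"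
    then have "DIM('v) = dim {u, J u}" by (metis dim_UNIV dim_span)
    also have "\<dots> \<le> card {u, J u}" by (rule dim_le_card') simp
    also have "\<dots> \<le> 2" by (simp add: card_insert_if)
    finally show False using dim by simp
  qed
  then obtain v where v: "v \<notin> span {u, J u}" by auto
  define pr where "pr = (\<lambda>x. x + cs (- h u x) u)"
  have pr: "h u (pr x) = 0" for x by (simp add: pr_def h_add h_cs' u)
  have "pr v \<noteq> 0"
  proof
    assume "pr v = 0"
    then have "v = (- Re (- h u v)) *\<^sub>R u + (- Im (- h u v)) *\<^sub>R J u"
      by (simp add: pr_def cs_def add_eq_0_iff2 algebra_simps)
    also have "\<dots> \<in> span {u, J u}" by (intro span_add span_scale span_base) auto
    finally show False using v by blast
  qed
  then obtain y where y: "h (pr v) y \<noteq> 0" using h_nd by blast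
  \<comment> \<open>Since \<open>pr v\<close> is orthogonal to \<open>u\<close>, projecting the
    other argument changes nothing. So \<open>h\<close> is nonzero on the complement of
    \<open>u\<close>, and polarisation finds a non-null vector there.\<close>
  have "h (pr v) (pr y) = h (pr v) y"
    using pr[of v] h_sym[of u "pr v"] unfolding pr_def[THEN fun_cong, of y] by (simp add: h_add h_cs')
  then obtain w0 where w0: "w0 \<in> {pr v, pr y, pr v + pr y}" "h w0 w0 \<noteq> 0"
    using polar[of "pr v" "pr y"] y by auto
  obtain c where c: "h (cs c w0) (cs c w0) = 1" using unit[OF w0(2)] by blast
  define w where "w = cs c w0"
  have "h u w0 = 0" using w0(1) by (auto simp: pr h_add)
  then have uw: "h u w = 0" "h w u = 0" "h w w = 1"
    using c h_sym[of w u] by (auto simp: w_def h_cs')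
  define n1 where "n1 = u + cs \<i> w"
  define n2 where "n2 = cs (1/2) (u + cs (- \<i>) w)"
  have n: "h n1 n1 = 0" "h n2 n2 = 0" "h n1 n2 = 1" "h n2 n1 = 1"
    by (simp_all add: n1_def n2_def h_add h_cs h_cs' u uw)
  define T where "T = (\<lambda>z. cs (fst z) n1 + cs (snd z) n2)"
  have T: "linear T" by (rule linearI) (simp_all add: T_def cs_def algebra_simps)
  \<comment> \<open>Pairing with the opposite null vector reads off a coordinate, which gives
    injectivity of \<open>T\<close>.\<close>
  have hT: "h (T z) n2 = fst z" "h (T z) n1 = snd z" for z
    by (simp_all add: T_def h_add h_cs n)
  have h0: "h 0 x = 0" for x using h_cs[of 0 0 x] by (simp add: cs_def)
  have bij: "bij T"
  proof (rule linear_inj_imp_bij[OF T])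
    fix z assume "T z = 0"
    then show "z = 0" using hT[of z] h0 by (simp add: prod_eq_iff)
  qed (simp add: dim)
  have "h (T z) (T w) = fst z * snd w + snd z * fst w" for z w
    by (simp add: T_def[THEN fun_cong, of w] h_add h_cs' hT mult.commute)
  moreover have "g x y = Re (h x y)" for x y by (simp add: h_def)
  ultimately have "g (T z) (T w) = null_form z w" for z w by (simp add: null_form_def)
  moreover have "T (\<i> * fst z, \<i> * snd z) = J (T z)" for z by (simp add: T_def cs_J Jl)
  ultimately show thesis using that T bij by blast
qed

text \<open>For a complex 2 by 2 matrix, skewness forces zero off-diagonal entries and opposite
  diagonal ones. Since \<open>null_form\<close> is only a real part, tests with \<i> multiples
  supply the imaginary parts.\<close>

lemma null_skew_diagonal:
  assumes L: "linear L" and J: "\<And>z. L (\<i> * fst z, \<i> * snd z) = (\<i> * fst (L z), \<i> * snd (L z))"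
    and skew: "\<And>z w. null_form (L z) w + null_form z (L w) = 0"
  shows "L z = (fst (L (1, 0)) * fst z, - (fst (L (1, 0)) * snd z))"
proof -
  obtain a b where P: "L (1, 0) = (a, b)" by (cases "L (1, 0)")
  obtain c d where Q: "L (0, 1) = (c, d)" by (cases "L (0, 1)")
  have P': "L (\<i>, 0) = (\<i> * a, \<i> * b)" and Q': "L (0, \<i>) = (\<i> * c, \<i> * d)"
    using J[of "(1, 0)"] J[of "(0, 1)"] P Q by auto
  have "b = 0" "c = 0" "d = - a"
    using skew[of "(1, 0)" "(1, 0)"] skew[of "(1, 0)" "(\<i>, 0)"] skew[of "(0, 1)" "(0, 1)"]
      skew[of "(0, 1)" "(0, \<i>)"] skew[of "(1, 0)" "(0, 1)"] skew[of "(1, 0)" "(0, \<i>)"]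
    by (auto simp: null_form_def P Q P' Q' complex_eq_iff)
  moreover have "z = Re (fst z) *\<^sub>R (1, 0) + Im (fst z) *\<^sub>R (\<i>, 0) + Re (snd z) *\<^sub>R (0, 1) + Im (snd z) *\<^sub>R (0, \<i>)"
    by (simp add: prod_eq_iff complex_eq_iff)
  then have "L z = L (Re (fst z) *\<^sub>R (1, 0) + Im (fst z) *\<^sub>R (\<i>, 0) + Re (snd z) *\<^sub>R (0, 1) + Im (snd z) *\<^sub>R (0, \<i>))"
    by (rule arg_cong)
  then have "L z = Re (fst z) *\<^sub>R L (1, 0) + Im (fst z) *\<^sub>R L (\<i>, 0) + Re (snd z) *\<^sub>R L (0, 1) + Im (snd z) *\<^sub>R L (0, \<i>)"
    by (simp only: linear_add[OF L] linear_scale[OF L])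
  ultimately show ?thesis
    by (simp add: P Q P' Q' prod_eq_iff complex_eq_iff)
qed

text \<open>The coefficients are the Wirtinger derivatives with respect to both coordinates and
  their conjugates.\<close>

lemma real_linear_expand:
  assumes "linear (\<rho> :: complex \<times> complex \<Rightarrow> complex)"
  obtains a b c d where "\<And>z. \<rho> z = a * fst z + b * cnj (fst z) + c * snd z + d * cnj (snd z)"
proof -
  define a where "a = (\<rho> (1, 0) - \<i> * \<rho> (\<i>, 0)) / 2"
  define b where "b = (\<rho> (1, 0) + \<i> * \<rho> (\<i>, 0)) / 2"
  define c where "c = (\<rho> (0, 1) - \<i> * \<rho> (0, \<i>)) / 2"
  define d where "d = (\<rho> (0, 1) + \<i> * \<rho> (0, \<i>)) / 2"
  have "\<rho> z = a * fst z + b * cnj (fst z) + c * snd z + d * cnj (snd z)" for z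
  proof -
    have "z = Re (fst z) *\<^sub>R (1, 0) + Im (fst z) *\<^sub>R (\<i>, 0) + Re (snd z) *\<^sub>R (0, 1) + Im (snd z) *\<^sub>R (0, \<i>)"
      by (simp add: prod_eq_iff complex_eq_iff)
    then have "\<rho> z = \<rho> (Re (fst z) *\<^sub>R (1, 0) + Im (fst z) *\<^sub>R (\<i>, 0) + Re (snd z) *\<^sub>R (0, 1) + Im (snd z) *\<^sub>R (0, \<i>))"
      by (rule arg_cong)
    then have "\<rho> z = Re (fst z) *\<^sub>R \<rho> (1, 0) + Im (fst z) *\<^sub>R \<rho> (\<i>, 0) + Re (snd z) *\<^sub>R \<rho> (0, 1) + Im (snd z) *\<^sub>R \<rho> (0, \<i>)"
      by (simp only: linear_add[OF assms] linear_scale[OF assms])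
    then show ?thesis
      by (simp add: a_def b_def c_def d_def complex_eq_iff field_simps)
  qed
  then show thesis by (rule that)
qed

text \<open>
  The Jacobi identity says that the two-form \<open>\<rho> \<circ> null_bracket \<rho>\<close> is annihilated by wedging with
  \<open>dz\<^sub>1\<close> and \<open>dz\<^sub>2\<close>, i.e. is a multiple of \<open>dz\<^sub>1 \<and> dz\<^sub>2\<close>; the five equations are
  the vanishing of its remaining coefficients.
\<close>

lemma jacobi_coefficients:
  assumes \<rho>: "\<And>z. \<rho> z = a * fst z + b * cnj (fst z) + c * snd z + d * cnj (snd z)"
    and jac: "\<And>x y z. null_bracket \<rho> x (null_bracket \<rho> y z) + null_bracket \<rho> y (null_bracket \<rho> z x) +
      null_bracket \<rho> z (null_bracket \<rho> x y) = 0"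
  shows "b * (cnj b - a) = 0" "d * (c - cnj d) = 0" "d * (a + cnj b) = 0" "b * (cnj d + c) = 0"
    "b * cnj c + cnj a * d = 0"
proof -
  define \<sigma> where "\<sigma> = (\<lambda>y z. \<rho> (null_bracket \<rho> y z))"
  have 1: "\<sigma> y z * fst x + \<sigma> z x * fst y + \<sigma> x y * fst z = 0"
    and 2: "\<sigma> y z * snd x + \<sigma> z x * snd y + \<sigma> x y * snd z = 0" for x y z
  proof -
    \<comment> \<open>In the cyclic sum the products of two values of \<rho> cancel and only the
      \<sigma> terms remain.\<close>
    have *: "fst (null_bracket \<rho> x (null_bracket \<rho> y z)) = \<rho> x * (\<rho> y * fst z - \<rho> z * fst y) - \<sigma> y z * fst x"
      "snd (null_bracket \<rho> x (null_bracket \<rho> y z)) = \<sigma> y z * snd x - \<rho> x * (\<rho> z * snd y - \<rho> y * snd z)" for x y z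
      by (simp_all add: null_bracket_def \<sigma>_def)
    show "\<sigma> y z * fst x + \<sigma> z x * fst y + \<sigma> x y * fst z = 0"
      using arg_cong[OF jac[of x y z], of fst] unfolding fst_add fst_zero * by algebra
    show "\<sigma> y z * snd x + \<sigma> z x * snd y + \<sigma> x y * snd z = 0"
      using arg_cong[OF jac[of x y z], of snd] unfolding snd_add snd_zero * by algebra
  qed
  note \<sigma> = \<sigma>_def null_bracket_def \<rho>
  \<comment> \<open>The indices 1 to 4 refer to the real basis \<open>(1, 0)\<close>,
    \<open>(\<i>, 0)\<close>, \<open>(0, 1)\<close>, \<open>(0, \<i>)\<close>. Each triple is chosen
    so that some components vanish and few \<sigma> terms survive.\<close>
  have s12: "\<sigma> (1, 0) (\<i>, 0) = 0" using 2[of "(1, 0)" "(\<i>, 0)" "(0, 1)"] by simp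
  have s34: "\<sigma> (0, 1) (0, \<i>) = 0" using 1[of "(1, 0)" "(0, 1)" "(0, \<i>)"] by simp
  have s23: "\<sigma> (\<i>, 0) (0, 1) + \<sigma> (0, 1) (1, 0) * \<i> = 0" using 1[of "(1, 0)" "(\<i>, 0)" "(0, 1)"] by simp
  have s24: "\<sigma> (\<i>, 0) (0, \<i>) + \<sigma> (0, \<i>) (1, 0) * \<i> = 0" using 1[of "(1, 0)" "(\<i>, 0)" "(0, \<i>)"] by simp
  have s14: "\<sigma> (0, \<i>) (1, 0) + \<sigma> (1, 0) (0, 1) * \<i> = 0" using 2[of "(1, 0)" "(0, 1)" "(0, \<i>)"] by (simp add: add.commute)
  have "2 * \<i> * (b * (cnj b - a)) = 0" using s12 unfolding \<sigma> by (auto simp: algebra_simps)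
  then show "b * (cnj b - a) = 0" by simp
  have "2 * \<i> * (d * (c - cnj d)) = 0" using s34 unfolding \<sigma> by (auto simp: algebra_simps)
  then show "d * (c - cnj d) = 0" by simp
  have "2 * \<i> * (b * (cnj d + c) + (b * cnj c + cnj a * d)) = 0"
    using s23 unfolding \<sigma> by (simp add: algebra_simps)
  then have 3: "b * (cnj d + c) + (b * cnj c + cnj a * d) = 0" by simp
  have "2 * \<i> * (d * (a + cnj b) + (b * cnj c + cnj a * d)) = 0"
    using s14 unfolding \<sigma> by (simp add: algebra_simps neg_eq_iff_add_eq_0)
  then have 4: "d * (a + cnj b) + (b * cnj c + cnj a * d) = 0" by simp
  have "2 * (b * (cnj d + c) - (b * cnj c + cnj a * d)) = 0"
    using s24 unfolding \<sigma> by (simp add: algebra_simps)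
  then have 5: "b * (cnj d + c) = b * cnj c + cnj a * d" by algebra
  \<comment> \<open>Writing \<open>P\<close>, \<open>Q\<close>, \<open>R\<close> for these three
    quantities, the relations are \<open>Q + R = 0\<close>, \<open>P + R = 0\<close> and
    \<open>Q = R\<close>.\<close>
  show "d * (a + cnj b) = 0" "b * (cnj d + c) = 0" "b * cnj c + cnj a * d = 0"
    using 3 4 5 by algebra+
qed

lemma Complex_arith:
  "Complex x y + Complex x' y' = Complex (x + x') (y + y')" "r *\<^sub>R Complex x y = Complex (r * x) (r * y)"
  by (simp_all add: complex_eq_iff)

lemma Complex_eq_0_iff: "Complex x y = 0 \<longleftrightarrow> x = 0 \<and> y = 0"
  by (simp add: complex_eq_iff)

lemma null_bracket_classification:
  assumes lin: "linear \<rho>"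
    and jac: "\<And>x y z. null_bracket \<rho> x (null_bracket \<rho> y z) + null_bracket \<rho> y (null_bracket \<rho> z x) +
      null_bracket \<rho> z (null_bracket \<rho> x y) = 0"
  obtains (abelian) "\<And>z w. null_bracket \<rho> z w = 0"
  | (r) S :: "real^4 \<Rightarrow> complex \<times> complex" where "linear S" "bij S"
      "\<And>x y. S (bracket_r x y) = null_bracket \<rho> (S x) (S y)"
  | (aff) S :: "real^4 \<Rightarrow> complex \<times> complex" where "linear S" "bij S"
      "\<And>x y. S (bracket_aff x y) = null_bracket \<rho> (S x) (S y)"
proof -
  obtain a b c d where \<rho>: "\<And>z. \<rho> z = a * fst z + b * cnj (fst z) + c * snd z + d * cnj (snd z)"
    using real_linear_expand[OF lin] by blast
  note coeff = jacobi_coefficients[OF \<rho> jac]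
  have bijI: "bij S" if "linear S" "\<And>x. S x = 0 \<Longrightarrow> x = 0" for S :: "real^4 \<Rightarrow> complex \<times> complex"
    using that by (rule linear_inj_imp_bij) (simp only: DIM_prod DIM_cart DIM_complex, simp)
  consider "b \<noteq> 0" | "b = 0" "d \<noteq> 0" | "b = 0" "d = 0" "a = 0" "c = 0" | "b = 0" "d = 0" "a \<noteq> 0 \<or> c \<noteq> 0"
    by blast
  then show thesis
  proof cases
    case 1
    with coeff have "a = cnj b" "d = 0" "c = 0" by auto
    with \<rho> have \<rho>: "\<rho> z = cnj b * fst z + b * cnj (fst z)" for z by simp
    \<comment> \<open>Division by \<open>2 * cnj b\<close> makes \<rho> the first real coordinate.
      Then \<open>e\<^sub>1\<close> acts by 1 on the remaining real direction of the first component
      and by -1 on the second component.\<close>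
    define S :: "real^4 \<Rightarrow> complex \<times> complex" where
      "S = (\<lambda>x. (Complex (x $ 1) (x $ 2) / (2 * cnj b), Complex (x $ 3) (x $ 4)))"
    have S: "linear S"
      by (rule linearI) (simp_all add: S_def Complex_arith[symmetric] add_divide_distrib scaleR_conv_of_real[where 'a=complex])
    have "bij S" by (rule bijI[OF S]) (use 1 in \<open>auto simp: S_def zero_prod_def vec_eq_iff forall_4 Complex_eq_0_iff\<close>)
    have "\<rho> (S x) = Complex (x $ 1) (x $ 2) / 2 + cnj (Complex (x $ 1) (x $ 2)) / 2" for x
      using 1 by (simp add: \<rho> S_def)
    then have \<rho>S: "\<rho> (S x) = x $ 1" for x
      by (simp add: complex_eq_iff)
    have "S (bracket_r x y) = null_bracket \<rho> (S x) (S y)" for x y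
    proof -
      have "Complex 0 (x $ 1 * y $ 2 - x $ 2 * y $ 1) =
          x $ 1 * Complex (y $ 1) (y $ 2) - y $ 1 * Complex (x $ 1) (x $ 2)"
        "Complex (- (x $ 1 * y $ 3 - x $ 3 * y $ 1)) (- (x $ 1 * y $ 4 - x $ 4 * y $ 1)) =
          y $ 1 * Complex (x $ 3) (x $ 4) - x $ 1 * Complex (y $ 3) (y $ 4)"
        by (simp_all add: complex_eq_iff)
      then show ?thesis
        unfolding null_bracket_def \<rho>S
        by (simp only: S_def bracket_r_nth fst_conv snd_conv) (simp add: diff_divide_distrib)
    qed
    then show thesis using r S \<open>bij S\<close> by blast
  next
    case 2
    with coeff have "a = 0" "c = cnj d" by auto
    with \<rho> 2 have \<rho>: "\<rho> z = cnj d * snd z + d * cnj (snd z)" for z by simp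
    \<comment> \<open>The components exchange roles. As \<rho> acts with a minus sign on the second
      one, the sign in \<open>S\<close> makes \<rho> equal to minus the first real
      coordinate.\<close>
    define S :: "real^4 \<Rightarrow> complex \<times> complex" where
      "S = (\<lambda>x. (Complex (x $ 3) (x $ 4), - (Complex (x $ 1) (x $ 2) / (2 * cnj d))))"
    have S: "linear S"
      by (rule linearI) (simp_all add: S_def Complex_arith[symmetric] add_divide_distrib scaleR_conv_of_real[where 'a=complex])
    have "bij S" by (rule bijI[OF S]) (use 2 in \<open>auto simp: S_def zero_prod_def vec_eq_iff forall_4 Complex_eq_0_iff\<close>)
    have "\<rho> (S x) = - (Complex (x $ 1) (x $ 2) / 2) - cnj (Complex (x $ 1) (x $ 2)) / 2" for x
      using 2 by (simp add: \<rho> S_def)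
    then have \<rho>S: "\<rho> (S x) = - (x $ 1)" for x
      by (simp add: complex_eq_iff)
    have "S (bracket_r x y) = null_bracket \<rho> (S x) (S y)" for x y
    proof -
      have "Complex 0 (x $ 1 * y $ 2 - x $ 2 * y $ 1) =
          x $ 1 * Complex (y $ 1) (y $ 2) - y $ 1 * Complex (x $ 1) (x $ 2)"
        "Complex (- (x $ 1 * y $ 3 - x $ 3 * y $ 1)) (- (x $ 1 * y $ 4 - x $ 4 * y $ 1)) =
          y $ 1 * Complex (x $ 3) (x $ 4) - x $ 1 * Complex (y $ 3) (y $ 4)"
        by (simp_all add: complex_eq_iff)
      then show ?thesis
        unfolding null_bracket_def \<rho>S
        by (simp only: S_def bracket_r_nth fst_conv snd_conv) (simp add: diff_divide_distrib)
    qed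
    then show thesis using r S \<open>bij S\<close> by blast
  next
    case 3
    with \<rho> have "null_bracket \<rho> z w = 0" for z w by (simp add: null_bracket_def zero_prod_def)
    then show thesis by (rule abelian)
  next
    case 4
    with \<rho> have \<rho>: "\<rho> z = a * fst z + c * snd z" for z by simp
    \<comment> \<open>For complex linear \<rho> the bracket is
      \<open>(z\<^sub>2 w\<^sub>1 - z\<^sub>1 w\<^sub>2) (c, a)\<close>, so \<open>(c, a)\<close>
      spans the derived algebra. The equation says that \<open>(u1, u2)\<close> acts on it by 1, and
      also that the two vectors are independent.\<close>
    obtain u1 u2 where u: "u2 * c - u1 * a = 1"
    proof (cases "a = 0")
      case True
      with 4 that[of "1 / c" 0] show thesis by simp
    next
      case False
      with that[of 0 "- 1 / a"] show thesis by simp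
    qed
    define \<alpha> where "\<alpha> = (\<lambda>x :: real^4. Complex (x $ 1) (x $ 2))"
    define \<beta> where "\<beta> = (\<lambda>x :: real^4. Complex (x $ 3) (x $ 4))"
    define S where "S = (\<lambda>x. (\<alpha> x * u1 + \<beta> x * c, \<alpha> x * u2 + \<beta> x * a))"
    have S: "linear S"
      by (rule linearI) (simp_all add: S_def \<alpha>_def \<beta>_def Complex_arith[symmetric] scaleR_conv_of_real[where 'a=complex] algebra_simps)
    have "bij S"
    proof (rule bijI[OF S])
      fix x assume "S x = 0"
      then have "\<alpha> x * u1 + \<beta> x * c = 0" "\<alpha> x * u2 + \<beta> x * a = 0" by (auto simp: S_def zero_prod_def)
      then have "\<alpha> x = 0" "\<beta> x = 0" using u by algebra+
      then show "x = 0" by (simp add: \<alpha>_def \<beta>_def vec_eq_iff forall_4 complex_eq_iff)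
    qed
    have "S (bracket_aff x y) = null_bracket \<rho> (S x) (S y)" for x y
    proof -
      \<comment> \<open>In the complex coordinates \<alpha> and \<beta> the second model is the
        complex affine algebra.\<close>
      have "\<alpha> (bracket_aff x y) = 0" "\<beta> (bracket_aff x y) = \<alpha> x * \<beta> y - \<beta> x * \<alpha> y"
        by (simp_all add: \<alpha>_def \<beta>_def bracket_aff_nth complex_eq_iff)
      then have "S (bracket_aff x y) = ((\<alpha> x * \<beta> y - \<beta> x * \<alpha> y) * c, (\<alpha> x * \<beta> y - \<beta> x * \<alpha> y) * a)"
        by (simp add: S_def)
      moreover have "fst (null_bracket \<rho> (S x) (S y)) = (\<alpha> x * \<beta> y - \<beta> x * \<alpha> y) * c"
        "snd (null_bracket \<rho> (S x) (S y)) = (\<alpha> x * \<beta> y - \<beta> x * \<alpha> y) * a"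
        unfolding null_bracket_def \<rho> S_def fst_conv snd_conv using u by algebra+
      ultimately show ?thesis by (simp add: prod_eq_iff)
    qed
    then show thesis using aff S \<open>bij S\<close> by blast
  qed
qed

section \<open>The classification\<close>

lemma left_frame_compose:
  fixes T :: "'w::real_vector \<Rightarrow> 'v::real_vector"
  assumes "left_frame A \<Phi>" "linear T" "bij T"
  shows "left_frame A (\<Phi> \<circ> T)"
  using assms bij_betw_trans[of T UNIV UNIV \<Phi> "lie_algebra A"]
  unfolding left_frame_def by (auto simp: linear_add linear_scale)

lemma lie_algebra_iso_iff:
  "lie_algebra_iso A br \<longleftrightarrow>
    (\<exists>\<Phi>. left_frame A \<Phi> \<and> (\<forall>x y. \<Phi> (br x y) = lie_bracket A (\<Phi> x) (\<Phi> y)))"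
  by (simp only: lie_algebra_iso_def left_frame_def conj_assoc)

lemma lie_algebra_isoI:
  assumes "left_frame A \<Phi>" "\<And>x y. lie_bracket A (\<Phi> x) (\<Phi> y) = \<Phi> (br x y)"
    and "linear S" "bij S" "\<And>x y. S (br' x y) = br (S x) (S y)"
  shows "lie_algebra_iso A br'"
  unfolding lie_algebra_iso_iff
  using left_frame_compose[OF assms(1,3,4)] assms(2,5) by (intro exI[of _ "\<Phi> \<circ> S"]) simp

lemma frame_null_coordinates:
  fixes A :: "('g::{topological_group_add, t2_space, second_countable_topology}, 'e::euclidean_space) atlas"
  assumes "lie_group A" and dim: "DIM('e) = 4" and ak: "left_invariant_anti_kaehler A g J"
  obtains \<Phi> \<rho> where "left_frame A \<Phi>" "linear \<rho>"
    "\<And>z w. lie_bracket A (\<Phi> z) (\<Phi> w) = \<Phi> (null_bracket \<rho> z w)"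
proof -
  interpret lie_grp A using assms(1) by unfold_locales
  obtain \<Phi>0 :: "'e \<Rightarrow> 'g vfield" where \<Phi>0: "left_frame A \<Phi>0" using left_frame_exists by blast
  interpret framed A \<Phi>0 using \<Phi>0 by unfold_locales
  obtain g0 :: "'e \<Rightarrow> 'e \<Rightarrow> real" and J0 :: "'e \<Rightarrow> 'e" and \<Gamma> :: "'e \<Rightarrow> 'e \<Rightarrow> 'e" where
    g: "bilinear g0" "\<And>x y. g0 x y = g0 y x" "\<And>x. \<forall>y. g0 x y = 0 \<Longrightarrow> x = 0" and
    J: "linear J0" "\<And>x. J0 (J0 x) = - x" "\<And>x y. g0 (J0 x) (J0 y) = - g0 x y" and
    G: "bilinear \<Gamma>" "\<And>x y. \<Gamma> x (J0 y) = J0 (\<Gamma> x y)" "\<And>x y z. g0 (\<Gamma> x y) z + g0 y (\<Gamma> x z) = 0" and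
    br: "\<And>x y. lie_bracket A (\<Phi>0 x) (\<Phi>0 y) = \<Phi>0 (\<Gamma> x y - \<Gamma> y x)"
    by (rule anti_kaehler_data[OF ak]) (rule that, assumption+)
  obtain T where T: "linear T" "bij T" "\<And>z. T (\<i> * fst z, \<i> * snd z) = J0 (T z)"
    "\<And>z w. g0 (T z) (T w) = null_form z w"
    by (rule null_basis_exists[OF dim g J]) (assumption, rule that, assumption+)
  have T_inv: "inv T (T z) = z" "T (inv T x) = x" for z x
    using T(2) by (simp_all add: bij_is_inj surj_f_inv_f bij_is_surj)
  have lin: "linear (inv T)"
    by (rule linearI; rule injD[OF bij_is_inj[OF T(2)]])
      (simp_all add: T_inv linear_add[OF T(1)] linear_scale[OF T(1)])
  define L where "L = (\<lambda>z w. inv T (\<Gamma> (T z) (T w)))"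
  have TL: "T (L z w) = \<Gamma> (T z) (T w)" for z w by (simp add: L_def T_inv)
  note Gl = bilinear_ladd[OF G(1)] bilinear_lmul[OF G(1)] bilinear_radd[OF G(1)] bilinear_rmul[OF G(1)]
  have L: "linear (L z)" "linear (\<lambda>z. L z w)" for z w
    by (rule linearI; simp add: L_def linear_add[OF T(1)] linear_scale[OF T(1)] Gl
        linear_add[OF lin] linear_scale[OF lin])+
  have LJ: "L z (\<i> * fst w, \<i> * snd w) = (\<i> * fst (L z w), \<i> * snd (L z w))" for z w
    by (rule injD[OF bij_is_inj[OF T(2)]]) (simp add: TL T(3) G(2))
  have Ls: "null_form (L x z) w + null_form z (L x w) = 0" for x z w
    using G(3)[of "T x" "T z" "T w"] by (simp add: T(4)[symmetric] TL)
  \<comment> \<open>\<open>L\<close> is complex linear in its second argument but only real linear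
    in the first, hence the conjugate terms in the expansion of \<rho>.\<close>
  define \<rho> where "\<rho> = (\<lambda>z. fst (L z (1, 0)))"
  have "linear \<rho>"
    by (rule linearI) (simp_all add: \<rho>_def linear_add[OF L(2)] linear_scale[OF L(2)])
  moreover have L\<rho>: "L z w = (\<rho> z * fst w, - (\<rho> z * snd w))" for z w
    unfolding \<rho>_def by (rule null_skew_diagonal[OF L(1) LJ Ls])
  then have "null_bracket \<rho> z w = L z w - L w z" for z w
    by (simp add: null_bracket_def L\<rho>)
  then have "T (null_bracket \<rho> z w) = \<Gamma> (T z) (T w) - \<Gamma> (T w) (T z)" for z w
    by (simp add: linear_diff[OF T(1)] TL)
  then have "lie_bracket A ((\<Phi>0 \<circ> T) z) ((\<Phi>0 \<circ> T) w) = (\<Phi>0 \<circ> T) (null_bracket \<rho> z w)" for z w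
    by (simp add: br)
  ultimately show thesis using that left_frame_compose[OF \<Phi>0 T(1,2)] by blast
qed

text \<open>A diagonal matrix with entries \<rho> and -\<rho> is complex linear and skew for every
  real linear \<rho>, and \<open>null_bracket\<close> is its antisymmetrisation. So a realisation of
  the bracket in this shape is all that remains to be found for each model.\<close>

lemma null_coordinates_anti_kaehler:
  assumes "lie_group A" "left_frame A \<Phi>" "linear \<rho>"
    and br: "\<And>z w. lie_bracket A (\<Phi> z) (\<Phi> w) = \<Phi> (null_bracket \<rho> z w)"
  shows "\<exists>g J. left_invariant_anti_kaehler A g J"
proof -
  interpret framed A \<Phi> using assms(1,2) by unfold_locales
  note \<rho>l = linear_add[OF assms(3)] linear_scale[OF assms(3)]
  show ?thesis
  proof (rule anti_kaehler_exists[of null_form "\<lambda>z. (\<i> * fst z, \<i> * snd z)"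
        "\<lambda>z w. (\<rho> z * fst w, - (\<rho> z * snd w))"])
    show "bilinear null_form"
      by (auto simp: bilinear_def linear_iff null_form_def algebra_simps)
    show "x = 0" if "\<forall>y. null_form x y = 0" for x
      using that[THEN spec, of "(1, 0)"] that[THEN spec, of "(\<i>, 0)"]
        that[THEN spec, of "(0, 1)"] that[THEN spec, of "(0, \<i>)"]
      by (simp add: null_form_def prod_eq_iff complex_eq_iff)
    show "linear (\<lambda>z::complex \<times> complex. (\<i> * fst z, \<i> * snd z))"
      by (auto simp: linear_iff algebra_simps)
    show "bilinear (\<lambda>z w. (\<rho> z * fst w, - (\<rho> z * snd w)))"
      by (auto simp: bilinear_def linear_iff \<rho>l algebra_simps)
    show "lie_bracket A (\<Phi> x) (\<Phi> y) =
      \<Phi> ((\<rho> x * fst y, - (\<rho> x * snd y)) - (\<rho> y * fst x, - (\<rho> y * snd x)))" for x y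
      by (simp add: br null_bracket_def)
  qed (simp_all add: null_form_def algebra_simps prod_eq_iff)
qed

theorem theorem6p1:
  fixes A :: "('g::{topological_group_add, t2_space, second_countable_topology}, real^4) atlas"
  assumes "lie_group A"
  shows "(\<exists>g J. left_invariant_anti_kaehler A g J) \<longleftrightarrow>
    abelian_lie_algebra A \<or> lie_algebra_iso A bracket_r \<or> lie_algebra_iso A bracket_aff"
proof
  assume "\<exists>g J. left_invariant_anti_kaehler A g J"
  then obtain g J where ak: "left_invariant_anti_kaehler A g J" by blast
  obtain \<Phi> \<rho> where \<Phi>: "left_frame A \<Phi>" "linear \<rho>"
    and br: "\<And>z w. lie_bracket A (\<Phi> z) (\<Phi> w) = \<Phi> (null_bracket \<rho> z w)"
    using frame_null_coordinates[OF assms _ ak] by auto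
  interpret framed A \<Phi> using assms \<Phi>(1) by unfold_locales
  consider (abelian) "\<forall>z w. null_bracket \<rho> z w = 0"
    | (r) S :: "real^4 \<Rightarrow> complex \<times> complex" where "linear S" "bij S"
      "\<forall>x y. S (bracket_r x y) = null_bracket \<rho> (S x) (S y)"
    | (aff) S :: "real^4 \<Rightarrow> complex \<times> complex" where "linear S" "bij S"
      "\<forall>x y. S (bracket_aff x y) = null_bracket \<rho> (S x) (S y)"
    by (rule null_bracket_classification[OF \<Phi>(2) frame_jacobi[OF br]]) blast+
  then show "abelian_lie_algebra A \<or> lie_algebra_iso A bracket_r \<or> lie_algebra_iso A bracket_aff"
  proof cases
    case abelian
    have "\<Phi> 0 = 0" using frame_scale[of 0 0] by (simp add: fscale_def tscale_def fun_eq_iff)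
    then have "lie_bracket A (\<Phi> z) (\<Phi> w) = 0" for z w by (simp add: br abelian)
    moreover have "lie_algebra A = range \<Phi>" using frame_bij by (simp add: bij_betw_def)
    ultimately have "abelian_lie_algebra A" unfolding abelian_lie_algebra_def by auto
    then show ?thesis by blast
  next
    case (r S)
    have "lie_algebra_iso A bracket_r"
      by (rule lie_algebra_isoI[OF \<Phi>(1) br r(1,2)]) (simp add: r(3))
    then show ?thesis by blast
  next
    case (aff S)
    have "lie_algebra_iso A bracket_aff"
      by (rule lie_algebra_isoI[OF \<Phi>(1) br aff(1,2)]) (simp add: aff(3))
    then show ?thesis by blast
  qed
next
  interpret lie_grp A using assms by unfold_locales
  define R :: "complex \<times> complex \<Rightarrow> real^4" where
    "R = (\<lambda>z. \<chi> i. if i = 1 then Re (fst z) else if i = 2 then Im (fst z)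
      else if i = 3 then Re (snd z) else Im (snd z))"
  have R: "linear R"
    by (rule linearI) (simp_all add: R_def vec_eq_iff forall_4)
  have R_bij: "bij R"
    by (rule linear_inj_imp_bij[OF R])
      (simp_all add: R_def vec_eq_iff forall_4 prod_eq_iff complex_eq_iff)
  \<comment> \<open>With \<open>\<rho> = snd\<close> the derived algebra is the first complex
    component, whereas \<open>bracket_aff\<close> has it in the last two real coordinates; hence the
    swap.\<close>
  define R' :: "complex \<times> complex \<Rightarrow> real^4" where "R' = R \<circ> prod.swap"
  have R': "linear R'" "bij R'"
    using R R_bij by (auto simp: R'_def linear_iff intro!: bij_comp)
  assume "abelian_lie_algebra A \<or> lie_algebra_iso A bracket_r \<or> lie_algebra_iso A bracket_aff"
  then consider "abelian_lie_algebra A" | "lie_algebra_iso A bracket_r" | "lie_algebra_iso A bracket_aff"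
    by blast
  then show "\<exists>g J. left_invariant_anti_kaehler A g J"
  proof cases
    case 1
    obtain \<Psi> :: "real^4 \<Rightarrow> 'g vfield" where \<Psi>: "left_frame A \<Psi>" using left_frame_exists by blast
    note \<Phi> = left_frame_compose[OF \<Psi> R R_bij]
    interpret framed A "\<Psi> \<circ> R" using \<Phi> by unfold_locales
    have "(\<Psi> \<circ> R) 0 = 0" using frame_scale[of 0 0] by (simp add: fscale_def tscale_def fun_eq_iff)
    \<comment> \<open>The abelian algebra is the case \<open>\<rho> = 0\<close>, where the frame is
      parallel.\<close>
    then have "lie_bracket A ((\<Psi> \<circ> R) z) ((\<Psi> \<circ> R) w) = (\<Psi> \<circ> R) (null_bracket (\<lambda>_. 0) z w)" for z w
      using 1 frame_lie_algebra unfolding abelian_lie_algebra_def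
      by (simp add: null_bracket_def zero_prod_def[symmetric])
    then show ?thesis
      using null_coordinates_anti_kaehler[OF assms \<Phi>, of "\<lambda>_. 0"] by (simp add: linear_zero)
  next
    case 2
    then obtain \<Psi> where \<Psi>: "left_frame A \<Psi>" "\<And>x y. lie_bracket A (\<Psi> x) (\<Psi> y) = \<Psi> (bracket_r x y)"
      unfolding lie_algebra_iso_iff by metis
    \<comment> \<open>This \<rho> is the solution of the Jacobi equations with
      \<open>a = b = 1/2\<close> and \<open>c = d = 0\<close>.\<close>
    have "bracket_r (R z) (R w) = R (null_bracket (\<lambda>z. Re (fst z)) z w)" for z w
      by (simp add: vec_eq_iff forall_4 bracket_r_nth R_def null_bracket_def)
    then show ?thesis
      using null_coordinates_anti_kaehler[OF assms left_frame_compose[OF \<Psi>(1) R R_bij],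
          of "\<lambda>z. Re (fst z)"] \<Psi>(2)
      by (simp add: linear_iff scaleR_conv_of_real)
  next
    case 3
    then obtain \<Psi> where \<Psi>: "left_frame A \<Psi>" "\<And>x y. lie_bracket A (\<Psi> x) (\<Psi> y) = \<Psi> (bracket_aff x y)"
      unfolding lie_algebra_iso_iff by metis
    have "bracket_aff (R' z) (R' w) = R' (null_bracket snd z w)" for z w
      by (simp add: vec_eq_iff forall_4 bracket_aff_nth R'_def R_def null_bracket_def algebra_simps)
    then show ?thesis
      using null_coordinates_anti_kaehler[OF assms left_frame_compose[OF \<Psi>(1) R'], of snd] \<Psi>(2)
      by (simp add: linear_iff)
  qed
qed

end
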